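(* Assume in addition to the setting in the context that $F_\xi$ is continuous for all $\xi$. Let $\alpha\in[0,1)$, $p\in(0,1]$, and $\tau=\frac{\sqrt{1-\alpha}}{L}\gamma$ with $\gamma\in(0,1)$. Then, almost surely, there exists $\mathbf z_*\in\mathsf{Sol}$ such that the sequence $(\mathbf z_k)$ generated by extragradient with variance reduction (described in the context) converges to $\mathbf z_*$.
   Context: Let $\mathcal Z$ be a finite-dimensional vector space with Euclidean inner product $\langle\cdot,\cdot\rangle$ and norm $\|\cdot\|$. Let $g:\mathcal Z\to\mathbb R\cup\{+\infty\}$ be proper convex lower semicontinuous, with $\operatorname{dom} g=\{\mathbf z: g(\mathbf z)<+\infty\}$ and $\operatorname{prox}_g(\mathbf x)=\operatorname{argmin}_{\mathbf y}\{g(\mathbf y)+\frac12\|\mathbf y-\mathbf x\|^2\}$. Problem: find $\mathbf z_*\in\mathcal Z$ such that $\langle F(\mathbf z_* ),\mathbf z-\mathbf z_*\rangle+g(\mathbf z)-g(\mathbf z_* )\ge 0$ for all $\mathbf z\in\mathcal Z$. The solution set $\mathsf{Sol}$ is assumed nonempty. The operator $F$ is monotone: $\langle F(\mathbf x)-F(\mathbf y),\mathbf x-\mathbf y\rangle\ge 0$ for all $\mathbf x,\mathbf y\in\operatorname{dom} g$. It has a stochastic oracle $F_\xi:\mathcal Z\to\mathcal Z$, where $\xi$ is random with distribution $Q$, that is unbiased, $F(\mathbf z)=\mathbb E[F_\xi(\mathbf z)]$, and $L$-Lipschitz in mean ($L>0$): $\mathbb E\|F_\xi(\mathbf u)-F_\xi(\mathbf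 v)\|^2\le L^2\|\mathbf u-\mathbf v\|^2$ for all $\mathbf u,\mathbf v\in\mathcal Z$. Extragradient with variance reduction: given $p\in(0,1]$, $\alpha\in[0,1)$, $\tau>0$ and deterministic $\mathbf z_0=\mathbf w_0$, for $k=0,1,\dots$: set $\bar{\mathbf z}_k=\alpha\mathbf z_k+(1-\alpha)\mathbf w_k$; $\mathbf z_{k+1/2}=\operatorname{prox}_{\tau g}(\bar{\mathbf z}_k-\tau F(\mathbf w_k))$; draw $\xi_k\sim Q$ (independently of the past); $\mathbf z_{k+1}=\operatorname{prox}_{\tau g}(\bar{\mathbf z}_k-\tau[F(\mathbf w_k)+F_{\xi_k}(\mathbf z_{k+1/2})-F_{\xi_k}(\mathbf w_k)])$; $\mathbf w_{k+1}=\mathbf z_{k+1}$ with probability $p$ and $\mathbf w_{k+1}=\mathbf w_k$ with probability $1-p$ (independently of everything else). *)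

theory Defs
  imports "HOL-Probability.Probability"
begin

text \<open>
  Functions into \<open>\<real> \<union> {+\<infinity>}\<close> are modelled as functions into
  \<^typ>\<open>ereal\<close>; properness rules out the value \<open>-\<infinity>\<close>.
\<close>

definition edom :: "('a \<Rightarrow> ereal) \<Rightarrow> 'a set" where
  "edom g = {z. g z < \<infinity>}"

definition proper_fun :: "('a \<Rightarrow> ereal) \<Rightarrow> bool" where
  "proper_fun g \<longleftrightarrow> (\<forall>z. g z \<noteq> -\<infinity>) \<and> edom g \<noteq> {}"

text \<open>At \<open>u = 0\<close> or \<open>v = 0\<close> the convention \<open>0 * \<infinity> = 0\<close> of \<^typ>\<open>ereal\<close> applies.\<close>

definition econvex_fun :: "('a::real_vector \<Rightarrow> ereal) \<Rightarrow> bool" where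
  "econvex_fun g \<longleftrightarrow> (\<forall>x y. \<forall>u\<ge>0. \<forall>v\<ge>0. u + v = 1 \<longrightarrow>
     g (u *\<^sub>R x + v *\<^sub>R y) \<le> ereal u * g x + ereal v * g y)"

definition lsc_fun :: "('a::topological_space \<Rightarrow> ereal) \<Rightarrow> bool" where
  "lsc_fun g \<longleftrightarrow> (\<forall>x. g x \<le> Liminf (at x) g)"

text \<open>
  The minimiser exists and is unique when \<open>g\<close> is proper, convex and lower semicontinuous on
  a Euclidean space, so the choice made by \<^const>\<open>arg_min\<close> is immaterial there.
\<close>

definition prox :: "('a::euclidean_space \<Rightarrow> ereal) \<Rightarrow> 'a \<Rightarrow> 'a" where
  "prox g x = arg_min (\<lambda>y. g y + ereal ((1/2) * (norm (y - x))\<^sup>2)) (\<lambda>_. True)"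

text \<open>
  In \<^typ>\<open>ereal\<close> one has \<open>\<infinity> - \<infinity> = \<infinity>\<close>. This is harmless: if \<open>g z = \<infinity>\<close>, the
  inequality fails for any \<open>z'\<close> in the domain of the proper function \<open>g\<close>, so
  every solution lies in \<open>edom g\<close>, and the difference is then unambiguous.
\<close>

definition VI_Sol :: "('a::euclidean_space \<Rightarrow> 'a) \<Rightarrow> ('a \<Rightarrow> ereal) \<Rightarrow> 'a set" where
  "VI_Sol F g = {z. \<forall>z'. ereal (F z \<bullet> (z' - z)) + g z' - g z \<ge> 0}"

definition monotone_operator_on :: "'a::real_inner set \<Rightarrow> ('a \<Rightarrow> 'a) \<Rightarrow> bool" where
  "monotone_operator_on S F \<longleftrightarrow> (\<forall>x\<in>S. \<forall>y\<in>S. (F x - F y) \<bullet> (x - y) \<ge> 0)"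

definition unbiased_oracle ::
    "'x measure \<Rightarrow> ('x \<Rightarrow> 'a \<Rightarrow> 'a) \<Rightarrow> ('a::euclidean_space \<Rightarrow> 'a) \<Rightarrow> bool" where
  "unbiased_oracle Q Fo F \<longleftrightarrow>
     (\<forall>z. integrable Q (\<lambda>x. Fo x z) \<and> F z = (\<integral>x. Fo x z \<partial>Q))"

definition lipschitz_in_mean ::
    "'x measure \<Rightarrow> ('x \<Rightarrow> 'a \<Rightarrow> 'a::euclidean_space) \<Rightarrow> real \<Rightarrow> bool" where
  "lipschitz_in_mean Q Fo L \<longleftrightarrow>
     (\<forall>u v. (\<integral>\<^sup>+x. ennreal ((norm (Fo x u - Fo x v))\<^sup>2) \<partial>Q) \<le> ennreal (L\<^sup>2 * (norm (u - v))\<^sup>2))"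

text \<open>
  \<open>\<xi> k\<close> is the sample drawn in step \<open>k\<close> and \<open>c k\<close> the coin deciding whether the
  snapshot \<open>w\<close> is updated. The pairs \<open>(\<xi> k, c k)\<close> are independent over \<open>k\<close>, and the law of
  each pair is the product of \<open>Q\<close> and a Bernoulli law; together this says that
  \<open>\<xi> 0, c 0, \<xi> 1, c 1, \<dots>\<close> are mutually independent, with \<open>\<xi> k\<close> distributed as \<open>Q\<close> and
  \<open>c k\<close> true with probability \<open>p\<close>. Measurability of the pairs is part of
  \<^const>\<open>prob_space.indep_vars\<close>.
\<close>

definition sampling ::
    "'w measure \<Rightarrow> 'x measure \<Rightarrow> real \<Rightarrow> (nat \<Rightarrow> 'w \<Rightarrow> 'x) \<Rightarrow> (nat \<Rightarrow> 'w \<Rightarrow> bool) \<Rightarrow> bool" where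
  "sampling M Q p \<xi> c \<longleftrightarrow>
     prob_space.indep_vars M (\<lambda>k. Q \<Otimes>\<^sub>M count_space UNIV) (\<lambda>k \<omega>. (\<xi> k \<omega>, c k \<omega>)) UNIV \<and>
     (\<forall>k. distr M (Q \<Otimes>\<^sub>M count_space UNIV) (\<lambda>\<omega>. (\<xi> k \<omega>, c k \<omega>)) =
          Q \<Otimes>\<^sub>M measure_pmf (bernoulli_pmf p))"

text \<open>
  One trajectory of extragradient with variance reduction, driven by a sample sequence \<open>x\<close>
  and a coin sequence \<open>c\<close>; \<open>zh k\<close> is the half-step iterate \<open>z\<^sub>k\<^sub>+\<^sub>1\<^sub>/\<^sub>2\<close>.
\<close>

definition extragradient_vr ::
    "('a::euclidean_space \<Rightarrow> ereal) \<Rightarrow> ('a \<Rightarrow> 'a) \<Rightarrow> ('x \<Rightarrow> 'a \<Rightarrow> 'a) \<Rightarrow> real \<Rightarrow> real \<Rightarrow> 'a \<Rightarrow>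
     (nat \<Rightarrow> 'x) \<Rightarrow> (nat \<Rightarrow> bool) \<Rightarrow> (nat \<Rightarrow> 'a) \<Rightarrow> (nat \<Rightarrow> 'a) \<Rightarrow> (nat \<Rightarrow> 'a) \<Rightarrow> bool" where
  "extragradient_vr g F Fo \<alpha> \<tau> z0 x c z zh w \<longleftrightarrow>
     z 0 = z0 \<and> w 0 = z0 \<and>
     (\<forall>k. let zbar = \<alpha> *\<^sub>R z k + (1 - \<alpha>) *\<^sub>R w k; P = prox (\<lambda>y. ereal \<tau> * g y) in
        zh k = P (zbar - \<tau> *\<^sub>R F (w k)) \<and>
        z (Suc k) = P (zbar - \<tau> *\<^sub>R (F (w k) + Fo (x k) (zh k) - Fo (x k) (w k))) \<and>
        w (Suc k) = (if c k then z (Suc k) else w k))"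

end

theory Submission
  imports Defs
begin

text \<open>
  Fix a solution \<open>s\<close> and weigh the squared distances of the iterate and of the snapshot by
  \<open>V\<^sub>k = \<alpha> \<bar>z\<^sub>k - s\<bar>\<^sup>2 + ((1 - \<alpha>) / p) \<bar>w\<^sub>k - s\<bar>\<^sup>2\<close>. Adding the variational inequalities of the two
  proximal steps, the inequality that defines a solution, and the monotonicity of \<open>F\<close> at the half step
  gives a bound on \<open>\<bar>z\<^sub>k\<^sub>+\<^sub>1 - s\<bar>\<^sup>2\<close> along every trajectory (\<open>pathwise_descent\<close>). It has two
  error terms: the term \<open>F (w\<^sub>k) + F\<^sub>\<xi> (z\<^sub>k\<^sub>+\<^sub>1\<^sub>/\<^sub>2) - F\<^sub>\<xi> (w\<^sub>k) - F (z\<^sub>k\<^sub>+\<^sub>1\<^sub>/\<^sub>2)\<close>, which has mean zero given the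
  past, and the square of \<open>F\<^sub>\<xi> (z\<^sub>k\<^sub>+\<^sub>1\<^sub>/\<^sub>2) - F\<^sub>\<xi> (w\<^sub>k)\<close>, whose mean is at most
  \<open>L\<^sup>2 \<bar>z\<^sub>k\<^sub>+\<^sub>1\<^sub>/\<^sub>2 - w\<^sub>k\<bar>\<^sup>2\<close>; the choice of \<open>\<tau>\<close> makes it a fraction \<open>\<gamma> < 1\<close> of the
  negative term that is available. The weight \<open>1 / p\<close> balances the coin: on average a fraction \<open>p\<close> of
  the snapshot's distance is replaced by that of the new iterate. Hence, given the past, \<open>V\<^sub>k\<close> decreases in mean by at
  least a multiple of \<open>\<bar>z\<^sub>k\<^sub>+\<^sub>1 - z\<^sub>k\<^sub>+\<^sub>1\<^sub>/\<^sub>2\<bar>\<^sup>2 + \<bar>z\<^sub>k\<^sub>+\<^sub>1\<^sub>/\<^sub>2 - w\<^sub>k\<bar>\<^sup>2\<close> (\<open>mean_descent\<close>).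

  So \<open>V\<^sub>k\<close> is a nonnegative supermartingale. It converges almost surely and its decrements are
  summable (\<open>robbins_siegmund\<close>). The convergence theorem for supermartingales rests on Doob's
  upcrossing argument: a trader who buys at or below \<open>a\<close> and sells at or above \<open>b\<close> gains at least
  \<open>b - a\<close> per sale and can never lose more than \<open>a\<close>, yet cannot gain on average, so the sales
  have a finite mean number.

  Applying this to a countable dense set of solutions gives one null set outside of which
  \<open>V\<^sub>k\<close> converges for all of them, and \<open>z\<^sub>k\<^sub>+\<^sub>1 - z\<^sub>k\<^sub>+\<^sub>1\<^sub>/\<^sub>2\<close>, \<open>z\<^sub>k\<^sub>+\<^sub>1\<^sub>/\<^sub>2 - w\<^sub>k\<close> vanish. The rest is deterministic
  (\<open>trajectory_converges\<close>). A new snapshot is either the new iterate or the old snapshot, so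
  also \<open>z\<^sub>k - w\<^sub>k\<close> vanishes. Passing to the limit in the first proximal step shows that
  cluster points of \<open>w\<^sub>k\<close> are solutions (\<open>limit_of_prox_steps_in_VI_Sol\<close>). A bounded sequence
  whose distances to a dense set of solutions converge, and whose cluster points are solutions, has only one
  cluster point (\<open>convergent_of_convergent_distances\<close>, Opial's argument).
\<close>

section \<open>Almost sure convergence of nonnegative supermartingales\<close>

text \<open>
  The state of a trader who buys when the price is at most \<open>a\<close> and sells when it is at
  least \<open>b\<close>. It is computed from the prices seen so far, so the strategy does not look ahead.
\<close>

primrec holding :: "real \<Rightarrow> real \<Rightarrow> (nat \<Rightarrow> real) \<Rightarrow> nat \<Rightarrow> bool" where
  "holding a b x 0 \<longleftrightarrow> x 0 \<le> a"
| "holding a b x (Suc n) \<longleftrightarrow> (if holding a b x n then x (Suc n) < b else x (Suc n) \<le> a)"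

definition sale :: "real \<Rightarrow> real \<Rightarrow> (nat \<Rightarrow> real) \<Rightarrow> nat \<Rightarrow> bool" where
  "sale a b x k \<longleftrightarrow> holding a b x k \<and> \<not> holding a b x (Suc k)"

text \<open>
  The right-hand side is the trader's gain. The second summand on the left bounds the paper profit on an open
  position from below; carrying it along makes the induction work.
\<close>

lemma upcrossing_gain:
  assumes "a < b"
  shows "(b - a) * (\<Sum>k<n. of_bool (sale a b x k)) + (if holding a b x n then x n - a else 0)
    \<le> (\<Sum>k<n. of_bool (holding a b x k) * (x (Suc k) - x k))"
proof (induction n)
  case (Suc n)
  have "(b - a) * of_bool (sale a b x n) + (if holding a b x (Suc n) then x (Suc n) - a else 0)
    \<le> (if holding a b x n then x n - a else 0) + of_bool (holding a b x n) * (x (Suc n) - x n)"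
    by (auto simp: sale_def)
  with Suc show ?case
    by (simp add: distrib_left del: holding.simps)
qed auto

text \<open>
  After the last sale the trader either holds forever, so the price stays below \<open>b\<close>, or never
  buys again, so it stays above \<open>a\<close>.
\<close>

lemma eventually_no_sale_dichotomy:
  assumes "eventually (\<lambda>k. \<not> sale a b x k) sequentially"
  shows "eventually (\<lambda>k. x k < b) sequentially \<or> eventually (\<lambda>k. a < x k) sequentially"
proof -
  obtain K where K: "\<And>k. K \<le> k \<Longrightarrow> \<not> sale a b x k"
    using assms by (auto simp: eventually_sequentially)
  show ?thesis
  proof (cases "\<exists>n\<ge>K. holding a b x n")
    case True
    then obtain n where n: "n \<ge> K" "holding a b x n" by blast
    have "holding a b x k" if "n \<le> k" for k
      using that
    proof (induction k rule: dec_induct)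
      case (step k)
      then show ?case using K[of k] n(1) by (simp add: sale_def)
    qed (use n in simp)
    then have "x (Suc k) < b" if "n \<le> k" for k
      using that by (metis holding.simps(2) le_SucI)
    then have "\<forall>k\<ge>Suc n. x k < b"
      by (metis Suc_le_D Suc_le_mono)
    then show ?thesis by (auto simp: eventually_sequentially)
  next
    case False
    then have "a < x (Suc k)" if "K \<le> k" for k
      using that by (metis holding.simps(2) le_SucI not_le)
    then have "\<forall>k\<ge>Suc K. a < x k"
      by (metis Suc_le_D Suc_le_mono)
    then show ?thesis by (auto simp: eventually_sequentially)
  qed
qed

text \<open>
  If the lower limit were below the upper one, two rationals strictly between them would contradict
  the dichotomy; the last hypothesis excludes divergence to \<open>\<infinity>\<close>.
\<close>

lemma convergent_if_no_oscillation:
  fixes x :: "nat \<Rightarrow> real"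
  assumes nonneg: "\<And>k. 0 \<le> x k"
    and dich: "\<And>a b. a \<in> \<rat> \<Longrightarrow> b \<in> \<rat> \<Longrightarrow> 0 \<le> a \<Longrightarrow> a < b \<Longrightarrow>
      eventually (\<lambda>k. x k < b) sequentially \<or> eventually (\<lambda>k. a < x k) sequentially"
    and freq: "frequently (\<lambda>k. x k < C) sequentially"
  shows "convergent x"
proof -
  let ?y = "\<lambda>k. ereal (x k)"
  have "0 \<le> liminf ?y"
    by (rule Liminf_bounded) (simp add: nonneg)
  moreover have "liminf ?y \<le> ereal C"
  proof (rule ccontr)
    assume "\<not> ?thesis"
    then have "eventually (\<lambda>k. ereal C < ?y k) sequentially"
      by (intro less_LiminfD) auto
    then show False
      using freq unfolding frequently_def by (auto elim: notE intro: eventually_mono)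
  qed
  ultimately obtain l where l: "liminf ?y = ereal l" "0 \<le> l"
    by (cases "liminf ?y") auto
  have "limsup ?y \<le> liminf ?y"
  proof (rule ccontr)
    assume "\<not> ?thesis"
    then have "ereal l < limsup ?y" using l by simp
    then obtain u where u: "ereal l < ereal u" "ereal u < limsup ?y"
      using ereal_dense2 by blast
    then obtain b where b: "b \<in> \<rat>" "l < b" "b < u"
      using Rats_dense_in_real[of l u] by auto
    then obtain a where a: "a \<in> \<rat>" "l < a" "a < b"
      using Rats_dense_in_real[of l b] by auto
    from dich[OF a(1) b(1) _ a(3)] a l(2) consider
      "eventually (\<lambda>k. x k < b) sequentially" | "eventually (\<lambda>k. a < x k) sequentially"
      by auto
    then show False
    proof cases
      case 1
      then have "limsup ?y \<le> ereal b"
        by (intro Limsup_bounded) (auto elim: eventually_mono)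
      then show False using u(2) b(3)
        by (meson ereal_less_eq(3) less_le_not_le order.strict_iff_order order_trans)
    next
      case 2
      then have "ereal a \<le> liminf ?y"
        by (intro Liminf_bounded) (auto elim: eventually_mono)
      then show False using l a(2) by simp
    qed
  qed
  then have "?y \<longlonglongrightarrow> ereal l"
    using l Liminf_le_Limsup[of sequentially ?y]
    by (intro Liminf_eq_Limsup) auto
  then show ?thesis
    by (auto simp: convergent_def)
qed

text \<open>
  The supermartingale property is stated through integrals over past events, which avoids
  conditional expectations. Nonnegativity of the price bounds the trader's loss by \<open>a\<close>, hence
  the expected number of sales by \<open>a / (b - a)\<close>; Borel-Cantelli then leaves finitely many sales for
  all rational \<open>a < b\<close> simultaneously. Fatou's lemma excludes the limit \<open>\<infinity>\<close>.
\<close>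

lemma nonneg_supermartingale_converges:
  fixes X :: "nat \<Rightarrow> 'w \<Rightarrow> real" and G :: "nat \<Rightarrow> 'w measure"
  assumes "prob_space M"
    and sub: "\<And>k. subalgebra M (G k)"
    and mono: "\<And>k. sets (G k) \<subseteq> sets (G (Suc k))"
    and adapted: "\<And>k. X k \<in> borel_measurable (G k)"
    and nonneg: "\<And>k \<omega>. 0 \<le> X k \<omega>"
    and init: "(\<integral>\<^sup>+\<omega>. X 0 \<omega> \<partial>M) < \<infinity>"
    and super: "\<And>k A. A \<in> sets (G k) \<Longrightarrow>
      (\<integral>\<^sup>+\<omega>. ennreal (X (Suc k) \<omega>) * indicator A \<omega> \<partial>M) \<le> (\<integral>\<^sup>+\<omega>. ennreal (X k \<omega>) * indicator A \<omega> \<partial>M)"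
  shows "AE \<omega> in M. convergent (\<lambda>k. X k \<omega>)"
proof -
  interpret prob_space M by fact
  have space_G: "space (G k) = space M" and sets_G: "sets (G k) \<subseteq> sets M" for k
    using sub[of k] by (auto simp: subalgebra_def)
  have meas[measurable]: "X k \<in> borel_measurable M" for k
    using measurable_from_subalg[OF sub adapted] .
  have bound: "(\<integral>\<^sup>+\<omega>. X k \<omega> \<partial>M) \<le> (\<integral>\<^sup>+\<omega>. X 0 \<omega> \<partial>M)" for k
  proof (induction k)
    case (Suc k)
    have "(\<integral>\<^sup>+\<omega>. X (Suc k) \<omega> \<partial>M) = (\<integral>\<^sup>+\<omega>. ennreal (X (Suc k) \<omega>) * indicator (space (G k)) \<omega> \<partial>M)"
      by (intro nn_integral_cong) (simp add: space_G)
    also have "\<dots> \<le> (\<integral>\<^sup>+\<omega>. ennreal (X k \<omega>) * indicator (space (G k)) \<omega> \<partial>M)"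
      by (rule super) simp
    also have "\<dots> = (\<integral>\<^sup>+\<omega>. X k \<omega> \<partial>M)"
      by (intro nn_integral_cong) (simp add: space_G)
    finally show ?case using Suc by simp
  qed simp
  have int[intro, simp]: "integrable M (X k)" for k
    using bound[of k] init nonneg by (intro integrableI_nonneg) auto
  \<comment> \<open>The gain of any strategy that decides on past information is nonpositive in mean.\<close>
  have step: "(\<integral>\<omega>. indicator A \<omega> * (X (Suc k) \<omega> - X k \<omega>) \<partial>M) \<le> 0" if "A \<in> sets (G k)" for k A
  proof -
    have [measurable]: "A \<in> sets M" using that sets_G by blast
    have i: "integrable M (\<lambda>\<omega>. indicator A \<omega> * X j \<omega>)" for j
      using integrable_mult_indicator[of A M "X j"] by simp
    have e: "(\<integral>\<^sup>+\<omega>. ennreal (X j \<omega>) * indicator A \<omega> \<partial>M) = ennreal (\<integral>\<omega>. indicator A \<omega> * X j \<omega> \<partial>M)" for j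
      using i[of j] nonneg
      by (subst nn_integral_eq_integral[symmetric])
        (auto intro!: nn_integral_cong simp: indicator_def)
    have "(\<integral>\<omega>. indicator A \<omega> * X (Suc k) \<omega> \<partial>M) \<le> (\<integral>\<omega>. indicator A \<omega> * X k \<omega> \<partial>M)"
      using super[OF that] nonneg by (simp add: e ennreal_le_iff integral_nonneg_AE)
    then show ?thesis
      using i by (simp add: right_diff_distrib Bochner_Integration.integral_diff)
  qed
  have hold: "{\<omega>\<in>space M. holding a b (\<lambda>k. X k \<omega>) n} \<in> sets (G n)" for a b n
  proof (induction n)
    case 0
    have "{\<omega>\<in>space (G 0). X 0 \<omega> \<le> a} \<in> sets (G 0)"
      using adapted[of 0] by measurable
    then show ?case by (simp add: space_G)
  next
    case (Suc n)
    have [measurable]: "{\<omega>\<in>space (G (Suc n)). holding a b (\<lambda>k. X k \<omega>) n} \<in> sets (G (Suc n))"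
      using Suc mono[of n] by (auto simp: space_G)
    note adapted[of "Suc n", measurable]
    have "{\<omega>\<in>space (G (Suc n)). if holding a b (\<lambda>k. X k \<omega>) n then X (Suc n) \<omega> < b else X (Suc n) \<omega> \<le> a}
      \<in> sets (G (Suc n))"
      by measurable
    then show ?case by (simp add: space_G)
  qed
  have hold_M: "{\<omega>\<in>space M. holding a b (\<lambda>k. X k \<omega>) n} \<in> sets M" for a b n
    using hold sets_G by blast
  have sales: "AE \<omega> in M. eventually (\<lambda>k. \<not> sale a b (\<lambda>k. X k \<omega>) k) sequentially"
    if ab: "0 \<le> a" "a < b" for a b
  proof -
    define S where "S k = {\<omega>\<in>space M. sale a b (\<lambda>k. X k \<omega>) k}" for k
    define H where "H k = {\<omega>\<in>space M. holding a b (\<lambda>k. X k \<omega>) k}" for k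
    have H[measurable]: "H k \<in> sets M" for k
      using hold_M by (simp add: H_def)
    have "S k = H k - H (Suc k)" for k
      by (auto simp: S_def H_def sale_def)
    then have S[measurable]: "S k \<in> sets M" for k by auto
    have i: "integrable M (\<lambda>\<omega>. indicator (H k) \<omega> * (X (Suc k) \<omega> - X k \<omega>))" for k
      using integrable_mult_indicator[of "H k" M "\<lambda>\<omega>. X (Suc k) \<omega> - X k \<omega>"] by simp
    have part: "(\<Sum>k<n. prob (S k)) \<le> a / (b - a)" for n
    proof -
      have iS: "integrable M (\<lambda>\<omega>. indicator (S k) \<omega> :: real)" for k
        by (simp add: emeasure_eq_measure)
      have "(b - a) * (\<Sum>k<n. prob (S k)) - a = (\<integral>\<omega>. (b - a) * (\<Sum>k<n. indicator (S k) \<omega>) - a \<partial>M)"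
        using iS by (simp add: prob_space)
      also have "\<dots> \<le> (\<integral>\<omega>. (\<Sum>k<n. indicator (H k) \<omega> * (X (Suc k) \<omega> - X k \<omega>)) \<partial>M)"
      proof (rule integral_mono)
        fix \<omega> assume \<omega>: "\<omega> \<in> space M"
        have "(b - a) * (\<Sum>k<n. indicator (S k) \<omega>) - a =
          (b - a) * (\<Sum>k<n. of_bool (sale a b (\<lambda>k. X k \<omega>) k)) - a"
          using \<omega> by (simp add: S_def indicator_def of_bool_def)
        also have "\<dots> \<le> (\<Sum>k<n. of_bool (holding a b (\<lambda>k. X k \<omega>) k) * (X (Suc k) \<omega> - X k \<omega>))"
          using upcrossing_gain[OF ab(2), of "\<lambda>k. X k \<omega>" n] nonneg[of n \<omega>] ab(1)
          by (auto split: if_splits)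
        also have "\<dots> = (\<Sum>k<n. indicator (H k) \<omega> * (X (Suc k) \<omega> - X k \<omega>))"
          using \<omega> by (simp add: H_def indicator_def of_bool_def)
        finally show "(b - a) * (\<Sum>k<n. indicator (S k) \<omega>) - a
          \<le> (\<Sum>k<n. indicator (H k) \<omega> * (X (Suc k) \<omega> - X k \<omega>))" .
      qed (intro Bochner_Integration.integrable_diff integrable_mult_right Bochner_Integration.integrable_sum i iS integrable_const)+
      also have "\<dots> = (\<Sum>k<n. \<integral>\<omega>. indicator (H k) \<omega> * (X (Suc k) \<omega> - X k \<omega>) \<partial>M)"
        by (rule Bochner_Integration.integral_sum) (rule i)
      also have "\<dots> \<le> 0"
        using step hold by (intro sum_nonpos) (simp add: H_def)
      finally show ?thesis using ab by (simp add: field_simps)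
    qed
    have "summable (\<lambda>k. prob (S k))"
      using part by (intro summableI_nonneg_bounded) auto
    then have "AE \<omega> in M. eventually (\<lambda>k. \<omega> \<in> space M - S k) sequentially"
      by (intro borel_cantelli_AE1) (auto simp: emeasure_eq_measure)
    then show ?thesis
      by eventually_elim (auto simp: S_def elim: eventually_mono)
  qed
  have "AE \<omega> in M. \<forall>a\<in>\<rat>. \<forall>b\<in>\<rat>. 0 \<le> a \<and> a < b \<longrightarrow> eventually (\<lambda>k. \<not> sale a b (\<lambda>k. X k \<omega>) k) sequentially"
    using sales by (auto simp: AE_ball_countable countable_rat)
  moreover have "AE \<omega> in M. liminf (\<lambda>k. ennreal (X k \<omega>)) \<noteq> \<infinity>"
  proof (rule nn_integral_PInf_AE)
    have "(\<integral>\<^sup>+\<omega>. liminf (\<lambda>k. ennreal (X k \<omega>)) \<partial>M) \<le> liminf (\<lambda>k. \<integral>\<^sup>+\<omega>. X k \<omega> \<partial>M)"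
      by (rule nn_integral_liminf) simp
    also have "\<dots> \<le> liminf (\<lambda>k::nat. \<integral>\<^sup>+\<omega>. X 0 \<omega> \<partial>M)"
      by (intro Liminf_mono) (simp add: bound)
    finally show "(\<integral>\<^sup>+\<omega>. liminf (\<lambda>k. ennreal (X k \<omega>)) \<partial>M) \<noteq> \<infinity>"
      using init by (auto simp: Liminf_const top_unique)
  qed simp
  ultimately show ?thesis
  proof eventually_elim
    case (elim \<omega>)
    from elim(2) have "liminf (\<lambda>k. ennreal (X k \<omega>)) < \<top>"
      by (simp add: less_top)
    then obtain l where "liminf (\<lambda>k. ennreal (X k \<omega>)) = ennreal l" "0 \<le> l"
      by (cases "liminf (\<lambda>k. ennreal (X k \<omega>))" rule: ennreal_cases) auto
    then obtain C where C: "liminf (\<lambda>k. ennreal (X k \<omega>)) < ennreal C"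
      using ennreal_lessI[of "l + 1" l] by (intro that[of "l + 1"]) auto
    have "frequently (\<lambda>k. X k \<omega> < C) sequentially"
    proof (rule ccontr)
      assume "\<not> ?thesis"
      then have "eventually (\<lambda>k. ennreal C \<le> ennreal (X k \<omega>)) sequentially"
        by (auto simp: frequently_def not_less elim!: eventually_mono intro: ennreal_leI)
      then have "ennreal C \<le> liminf (\<lambda>k. ennreal (X k \<omega>))"
        by (rule Liminf_bounded)
      then show False using C by simp
    qed
    moreover have "eventually (\<lambda>k. X k \<omega> < b) sequentially \<or> eventually (\<lambda>k. a < X k \<omega>) sequentially"
      if "a \<in> \<rat>" "b \<in> \<rat>" "0 \<le> a" "a < b" for a b
      using eventually_no_sale_dichotomy[of a b "\<lambda>k. X k \<omega>"] elim(1) that by blast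
    ultimately show ?case
      using nonneg convergent_if_no_oscillation[of "\<lambda>k. X k \<omega>" C] by blast
  qed
qed

text \<open>
  Telescoping the expectations bounds the mean of \<open>\<Sum>k. D k\<close> by that of \<open>X 0\<close>.
\<close>

lemma robbins_siegmund:
  fixes X D :: "nat \<Rightarrow> 'w \<Rightarrow> real" and G :: "nat \<Rightarrow> 'w measure"
  assumes "prob_space M"
    and sub: "\<And>k. subalgebra M (G k)"
    and mono: "\<And>k. sets (G k) \<subseteq> sets (G (Suc k))"
    and adapted: "\<And>k. X k \<in> borel_measurable (G k)"
    and D[measurable]: "\<And>k. D k \<in> borel_measurable M"
    and X_nonneg: "\<And>k \<omega>. 0 \<le> X k \<omega>" and D_nonneg: "\<And>k \<omega>. 0 \<le> D k \<omega>"
    and init: "(\<integral>\<^sup>+\<omega>. X 0 \<omega> \<partial>M) < \<infinity>"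
    and descent: "\<And>k A. A \<in> sets (G k) \<Longrightarrow>
      (\<integral>\<^sup>+\<omega>. ennreal (X (Suc k) \<omega> + D k \<omega>) * indicator A \<omega> \<partial>M)
        \<le> (\<integral>\<^sup>+\<omega>. ennreal (X k \<omega>) * indicator A \<omega> \<partial>M)"
  shows "AE \<omega> in M. convergent (\<lambda>k. X k \<omega>) \<and> summable (\<lambda>k. D k \<omega>)"
proof -
  interpret prob_space M by fact
  have space_G: "space (G k) = space M" for k
    using sub[of k] by (auto simp: subalgebra_def)
  have [measurable]: "X k \<in> borel_measurable M" for k
    using measurable_from_subalg[OF sub adapted] .
  have "AE \<omega> in M. convergent (\<lambda>k. X k \<omega>)"
  proof (rule nonneg_supermartingale_converges[OF \<open>prob_space M\<close> sub mono adapted X_nonneg init])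
    fix k A assume A: "A \<in> sets (G k)"
    have "(\<integral>\<^sup>+\<omega>. ennreal (X (Suc k) \<omega>) * indicator A \<omega> \<partial>M)
      \<le> (\<integral>\<^sup>+\<omega>. ennreal (X (Suc k) \<omega> + D k \<omega>) * indicator A \<omega> \<partial>M)"
      using D_nonneg by (intro nn_integral_mono mult_right_mono ennreal_leI) auto
    then show "(\<integral>\<^sup>+\<omega>. ennreal (X (Suc k) \<omega>) * indicator A \<omega> \<partial>M)
      \<le> (\<integral>\<^sup>+\<omega>. ennreal (X k \<omega>) * indicator A \<omega> \<partial>M)"
      using descent[OF A] by (rule order_trans)
  qed
  moreover have "AE \<omega> in M. (\<Sum>k. ennreal (D k \<omega>)) \<noteq> \<infinity>"
  proof (rule nn_integral_PInf_AE)
    have step: "(\<integral>\<^sup>+\<omega>. X (Suc k) \<omega> \<partial>M) + (\<integral>\<^sup>+\<omega>. D k \<omega> \<partial>M) \<le> (\<integral>\<^sup>+\<omega>. X k \<omega> \<partial>M)" for k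
    proof -
      have "(\<integral>\<^sup>+\<omega>. X (Suc k) \<omega> \<partial>M) + (\<integral>\<^sup>+\<omega>. D k \<omega> \<partial>M) =
        (\<integral>\<^sup>+\<omega>. ennreal (X (Suc k) \<omega> + D k \<omega>) * indicator (space (G k)) \<omega> \<partial>M)"
        using X_nonneg D_nonneg
        by (subst nn_integral_add[symmetric]) (auto simp: space_G ennreal_plus intro!: nn_integral_cong)
      also have "\<dots> \<le> (\<integral>\<^sup>+\<omega>. ennreal (X k \<omega>) * indicator (space (G k)) \<omega> \<partial>M)"
        by (rule descent) simp
      also have "\<dots> = (\<integral>\<^sup>+\<omega>. X k \<omega> \<partial>M)"
        by (intro nn_integral_cong) (simp add: space_G)
      finally show ?thesis .
    qed
    have "(\<integral>\<^sup>+\<omega>. X n \<omega> \<partial>M) + (\<Sum>k<n. \<integral>\<^sup>+\<omega>. D k \<omega> \<partial>M) \<le> (\<integral>\<^sup>+\<omega>. X 0 \<omega> \<partial>M)" for n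
    proof (induction n)
      case (Suc n)
      have "(\<integral>\<^sup>+\<omega>. X (Suc n) \<omega> \<partial>M) + (\<Sum>k<Suc n. \<integral>\<^sup>+\<omega>. D k \<omega> \<partial>M)
        = ((\<integral>\<^sup>+\<omega>. X (Suc n) \<omega> \<partial>M) + (\<integral>\<^sup>+\<omega>. D n \<omega> \<partial>M)) + (\<Sum>k<n. \<integral>\<^sup>+\<omega>. D k \<omega> \<partial>M)"
        by (simp add: ac_simps)
      also have "\<dots> \<le> (\<integral>\<^sup>+\<omega>. X n \<omega> \<partial>M) + (\<Sum>k<n. \<integral>\<^sup>+\<omega>. D k \<omega> \<partial>M)"
        by (rule add_right_mono) (rule step)
      also note Suc
      finally show ?case .
    qed simp
    then have "(\<Sum>k<n. \<integral>\<^sup>+\<omega>. D k \<omega> \<partial>M) \<le> (\<integral>\<^sup>+\<omega>. X 0 \<omega> \<partial>M)" for n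
      by (meson add_increasing order_refl order_trans zero_le)
    then have "(\<Sum>k. \<integral>\<^sup>+\<omega>. D k \<omega> \<partial>M) \<le> (\<integral>\<^sup>+\<omega>. X 0 \<omega> \<partial>M)"
      by (intro suminf_le_const) auto
    then show "(\<integral>\<^sup>+\<omega>. (\<Sum>k. ennreal (D k \<omega>)) \<partial>M) \<noteq> \<infinity>"
      using init by (subst nn_integral_suminf) auto
  qed simp
  ultimately show ?thesis
    by eventually_elim (auto intro!: summable_suminf_not_top D_nonneg)
qed

section \<open>Independence of the present draw from the past\<close>

text \<open>
  The sigma-algebra generated by the draws before \<open>k\<close>.
\<close>

definition past_algebra :: "'w measure \<Rightarrow> 'y measure \<Rightarrow> (nat \<Rightarrow> 'w \<Rightarrow> 'y) \<Rightarrow> nat \<Rightarrow> 'w measure" where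
  "past_algebra M N Y k =
     vimage_algebra (space M) (\<lambda>\<omega>. restrict (\<lambda>i. Y i \<omega>) {..<k}) (PiM {..<k} (\<lambda>_. N))"

lemma space_past_algebra[simp]: "space (past_algebra M N Y k) = space M"
  by (simp add: past_algebra_def)

context
  fixes M :: "'w measure" and N :: "'y measure" and Y :: "nat \<Rightarrow> 'w \<Rightarrow> 'y"
  assumes Y: "\<And>i. Y i \<in> measurable M N"
begin

lemma measurable_past_history:
  "(\<lambda>\<omega>. restrict (\<lambda>i. Y i \<omega>) {..<k}) \<in> measurable (past_algebra M N Y k) (PiM {..<k} (\<lambda>_. N))"
  unfolding past_algebra_def
  using measurable_space[OF Y] by (intro measurable_vimage_algebra1) (auto simp: space_PiM)

lemma measurable_past: "i < k \<Longrightarrow> Y i \<in> measurable (past_algebra M N Y k) N"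
  using measurable_compose[OF measurable_past_history measurable_component_singleton[of i]] by simp

lemma sets_past_algebra_least:
  assumes "space N' = space M" "\<And>i. i < k \<Longrightarrow> Y i \<in> measurable N' N"
  shows "sets (past_algebra M N Y k) \<subseteq> sets N'"
  unfolding past_algebra_def using assms
  by (intro sets_image_in_sets measurable_restrict) auto

lemma subalgebra_past: "subalgebra M (past_algebra M N Y k)"
  unfolding subalgebra_def using sets_past_algebra_least[of M k] Y by simp

lemma sets_past_mono: "sets (past_algebra M N Y k) \<subseteq> sets (past_algebra M N Y (Suc k))"
  by (rule sets_past_algebra_least) (auto intro: measurable_past)

text \<open>
  The draws before \<open>k\<close> and the draw \<open>k\<close> use disjoint index sets, so independence of the family
  separates the sigma-algebras that they generate.
\<close>

lemma indep_past_present: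
  assumes "prob_space M" "prob_space.indep_vars M (\<lambda>_. N) Y UNIV"
  shows "prob_space.indep_set M (sets (past_algebra M N Y k)) {Y k -` A \<inter> space M |A. A \<in> sets N}"
proof -
  interpret prob_space M by fact
  let ?H = "\<lambda>\<omega>. restrict (\<lambda>i. Y i \<omega>) {..<k}" and ?P = "PiM {..<k} (\<lambda>_. N)"
  let ?J = "\<lambda>\<omega>. restrict (\<lambda>i. Y i \<omega>) {k}" and ?K = "PiM {k} (\<lambda>_. N)"
  have "indep_var ?P ?H ?K ?J"
    by (rule indep_var_restrict[OF assms(2)]) auto
  then have ind: "indep_set (sigma_sets (space M) {?H -` A \<inter> space M |A. A \<in> sets ?P})
      (sigma_sets (space M) {?J -` A \<inter> space M |A. A \<in> sets ?K})"
    unfolding indep_var_eq by (elim conjE)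
  have present: "{Y k -` A \<inter> space M |A. A \<in> sets N}
    \<subseteq> sigma_sets (space M) {?J -` A \<inter> space M |A. A \<in> sets ?K}"
  proof
    fix E assume "E \<in> {Y k -` A \<inter> space M |A. A \<in> sets N}"
    then obtain A where E: "E = Y k -` A \<inter> space M" and A: "A \<in> sets N" by blast
    let ?B = "(\<lambda>f. f k) -` A \<inter> space ?K"
    have B: "?B \<in> sets ?K"
      using A by (intro measurable_sets[OF measurable_component_singleton]) auto
    have "E = ?J -` ?B \<inter> space M"
      using measurable_space[OF Y[of k]] by (auto simp: space_PiM E)
    then have "E \<in> {?J -` A \<inter> space M |A. A \<in> sets ?K}"
      using B by blast
    then show "E \<in> sigma_sets (space M) {?J -` A \<inter> space M |A. A \<in> sets ?K}"
      by (rule sigma_sets.Basic)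
  qed
  have past: "sets (past_algebra M N Y k) \<subseteq> sigma_sets (space M) {?H -` A \<inter> space M |A. A \<in> sets ?P}"
    unfolding past_algebra_def sets_vimage_algebra by (rule order_refl)
  show ?thesis
    unfolding indep_set_def
  proof (rule indep_sets_mono_sets[OF ind[unfolded indep_set_def]])
    fix i :: bool
    show "case_bool (sets (past_algebra M N Y k)) {Y k -` A \<inter> space M |A. A \<in> sets N} i
      \<subseteq> case_bool (sigma_sets (space M) {?H -` A \<inter> space M |A. A \<in> sets ?P})
          (sigma_sets (space M) {?J -` A \<inter> space M |A. A \<in> sets ?K}) i"
      using past present by (cases i) simp_all
  qed
qed

text \<open>
  Any state computed from the past is jointly distributed with the present draw as a product,
  also when state and draw have values in different types.
\<close>

lemma distr_past_present:
  assumes "prob_space M" "prob_space.indep_vars M (\<lambda>_. N) Y UNIV"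
    and S: "S \<in> measurable (past_algebra M N Y k) N'"
  shows "distr M N' S \<Otimes>\<^sub>M distr M N (Y k) = distr M (N' \<Otimes>\<^sub>M N) (\<lambda>\<omega>. (S \<omega>, Y k \<omega>))"
proof -
  interpret prob_space M by fact
  have S': "S \<in> measurable M N'" by (rule measurable_from_subalg[OF subalgebra_past S])
  note Y[measurable] S'[measurable]
  interpret D: prob_space "distr M N (Y k)" by (rule prob_space_distr) (rule Y)
  interpret D': prob_space "distr M N' S" by (rule prob_space_distr) (rule S')
  show ?thesis
  proof (rule pair_measure_eqI)
    fix A B assume "A \<in> sets (distr M N' S)" "B \<in> sets (distr M N (Y k))"
    then have A[measurable]: "A \<in> sets N'" and B[measurable]: "B \<in> sets N" by simp_all
    have "S -` A \<inter> space M \<in> sets (past_algebra M N Y k)"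
      using measurable_sets[OF S A] by simp
    then have "prob ((S -` A \<inter> space M) \<inter> (Y k -` B \<inter> space M))
      = prob (S -` A \<inter> space M) * prob (Y k -` B \<inter> space M)"
      using B by (intro indep_setD[OF indep_past_present[OF assms(1,2)]]) auto
    moreover have "(\<lambda>\<omega>. (S \<omega>, Y k \<omega>)) -` (A \<times> B) \<inter> space M
      = (S -` A \<inter> space M) \<inter> (Y k -` B \<inter> space M)"
      by auto
    ultimately show "emeasure (distr M N' S) A * emeasure (distr M N (Y k)) B
      = emeasure (distr M (N' \<Otimes>\<^sub>M N) (\<lambda>\<omega>. (S \<omega>, Y k \<omega>))) (A \<times> B)"
      by (simp add: emeasure_distr emeasure_eq_measure ennreal_mult'')
  qed (unfold_locales, simp cong: sets_pair_measure_cong)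
qed

text \<open>
  The present draw can be averaged out first, with the state frozen. This is what
  conditioning on the past amounts to here.
\<close>

lemma nn_integral_past_present:
  assumes "prob_space M" "prob_space.indep_vars M (\<lambda>_. N) Y UNIV"
    and S: "S \<in> measurable (past_algebra M N Y k) N'"
    and f: "f \<in> borel_measurable (N' \<Otimes>\<^sub>M N)"
  shows "(\<integral>\<^sup>+\<omega>. f (S \<omega>, Y k \<omega>) \<partial>M) = (\<integral>\<^sup>+\<omega>. \<integral>\<^sup>+y. f (S \<omega>, y) \<partial>distr M N (Y k) \<partial>M)"
proof -
  interpret prob_space M by fact
  interpret D: prob_space "distr M N (Y k)" by (rule prob_space_distr) (rule Y)
  have S': "S \<in> measurable M N'" by (rule measurable_from_subalg[OF subalgebra_past S])
  note Y[measurable] S'[measurable] f[measurable]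
  have "(\<integral>\<^sup>+\<omega>. f (S \<omega>, Y k \<omega>) \<partial>M) = integral\<^sup>N (distr M (N' \<Otimes>\<^sub>M N) (\<lambda>\<omega>. (S \<omega>, Y k \<omega>))) f"
    by (rule nn_integral_distr[symmetric]) auto
  also have "\<dots> = integral\<^sup>N (distr M N' S \<Otimes>\<^sub>M distr M N (Y k)) f"
    by (simp only: distr_past_present[OF assms(1-3)])
  also have "\<dots> = (\<integral>\<^sup>+s. \<integral>\<^sup>+y. f (s, y) \<partial>distr M N (Y k) \<partial>distr M N' S)"
    by (rule D.nn_integral_fst[symmetric]) simp
  also have "\<dots> = (\<integral>\<^sup>+\<omega>. \<integral>\<^sup>+y. f (S \<omega>, y) \<partial>distr M N (Y k) \<partial>M)"
    by (rule nn_integral_distr[OF S']) (rule D.borel_measurable_nn_integral_fst, simp)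
  finally show ?thesis .
qed

end

section \<open>Proximal maps of convex lower semicontinuous functions\<close>

lemma lsc_fun_sequentially:
  assumes "lsc_fun g" and "X \<longlonglongrightarrow> x"
  shows "g x \<le> liminf (\<lambda>n. g (X n))"
proof (subst le_Liminf_iff, intro allI impI)
  fix y assume "y < g x"
  then have "eventually (\<lambda>u. y < g u) (at x)"
    using assms(1) by (auto simp: lsc_fun_def le_Liminf_iff)
  then have "eventually (\<lambda>u. y < g u) (nhds x)"
    using \<open>y < g x\<close> by (auto simp: eventually_at_filter elim: eventually_mono)
  then show "eventually (\<lambda>n. y < g (X n)) sequentially"
    using assms(2) by (auto simp: filterlim_iff)
qed

lemma lsc_fun_le_of_tendsto:
  assumes "lsc_fun g" "X \<longlonglongrightarrow> x" "B \<longlonglongrightarrow> b" "\<And>n. g (X n) \<le> ereal (B n)"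
  shows "g x \<le> ereal b"
proof -
  have "g x \<le> liminf (\<lambda>n. g (X n))"
    by (rule lsc_fun_sequentially) fact+
  also have "\<dots> \<le> liminf (\<lambda>n. ereal (B n))"
    by (intro Liminf_mono) (simp add: assms)
  also have "\<dots> = ereal b"
    using assms(3) by (intro lim_imp_Liminf) auto
  finally show ?thesis .
qed

text \<open>
  The summands are kept apart because the continuous one converges along a minimising
  sequence, and then the lower limits add up.
\<close>

lemma lsc_plus_continuous_attains_inf_compact:
  fixes f :: "'a::metric_space \<Rightarrow> ereal" and q :: "'a \<Rightarrow> real"
  assumes "lsc_fun f" "continuous_on UNIV q" "compact K" "K \<noteq> {}"
  obtains x where "x \<in> K" "\<And>y. y \<in> K \<Longrightarrow> f x + q x \<le> f y + q y"
proof -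
  let ?h = "\<lambda>x. f x + ereal (q x)"
  obtain u where u: "range u \<subseteq> ?h ` K" "u \<longlonglongrightarrow> Inf (?h ` K)"
    using Inf_as_limit[of "?h ` K"] assms(4) by auto
  then have "\<forall>n. \<exists>y\<in>K. u n = ?h y" by auto
  then obtain v where v: "\<And>n. v n \<in> K" "\<And>n. u n = ?h (v n)" by metis
  obtain x r where xr: "x \<in> K" "strict_mono r" "(v \<circ> r) \<longlonglongrightarrow> x"
    using assms(3) v(1) unfolding compact_def by metis
  have "(\<lambda>n. q ((v \<circ> r) n)) \<longlonglongrightarrow> q x"
    by (rule continuous_on_tendsto_compose[OF assms(2) xr(3)]) auto
  then have q: "liminf (\<lambda>n. ereal (q ((v \<circ> r) n))) = ereal (q x)"
    by (intro lim_imp_Liminf) auto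
  have "?h x \<le> liminf (\<lambda>n. f ((v \<circ> r) n)) + liminf (\<lambda>n. ereal (q ((v \<circ> r) n)))"
    unfolding q by (intro add_mono lsc_fun_sequentially[OF assms(1) xr(3)] order_refl)
  also have "\<dots> \<le> liminf (\<lambda>n. ?h ((v \<circ> r) n))"
    by (intro ereal_liminf_add_mono) (simp only: q, simp)
  also have "\<dots> = Inf (?h ` K)"
    using LIMSEQ_subseq_LIMSEQ[OF u(2) xr(2)] v(2)
    by (intro lim_imp_Liminf) (auto simp: o_def)
  finally show ?thesis
    using xr(1) by (intro that[of x]) (auto intro: order_trans Inf_lower)
qed

lemma proper_fun_scale:
  assumes "proper_fun g" "0 < t"
  shows "proper_fun (\<lambda>y. ereal t * g y)"
proof -
  obtain z where "g z < \<infinity>" using assms(1) by (auto simp: proper_fun_def edom_def)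
  then have "ereal t * g z < \<infinity>"
    using assms(2) by (cases "g z") auto
  moreover have "ereal t * g z \<noteq> - \<infinity>" for z
    using assms by (cases "g z") (auto simp: proper_fun_def)
  ultimately show ?thesis by (auto simp: proper_fun_def edom_def)
qed

lemma econvex_fun_scale:
  assumes "econvex_fun g" "0 < t" "\<And>z. g z \<noteq> -\<infinity>"
  shows "econvex_fun (\<lambda>y. ereal t * g y)"
  unfolding econvex_fun_def
proof (intro allI impI)
  fix x y and u v :: real assume uv: "0 \<le> u" "0 \<le> v" "u + v = 1"
  have "g (u *\<^sub>R x + v *\<^sub>R y) \<le> ereal u * g x + ereal v * g y"
    using assms(1) uv unfolding econvex_fun_def by blast
  then have "ereal t * g (u *\<^sub>R x + v *\<^sub>R y) \<le> ereal t * (ereal u * g x + ereal v * g y)"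
    using assms(2) by (simp add: ereal_mult_left_mono)
  also have "\<dots> = ereal u * (ereal t * g x) + ereal v * (ereal t * g y)"
    using assms(3)[of x] assms(3)[of y] uv(1,2) assms(2)
    by (cases "g x"; cases "g y"; cases "u = 0"; cases "v = 0")
      (simp_all add: distrib_left mult.left_commute zero_ereal_def[symmetric])
  finally show "ereal t * g (u *\<^sub>R x + v *\<^sub>R y) \<le> ereal u * (ereal t * g x) + ereal v * (ereal t * g y)" .
qed

lemma lsc_fun_scale:
  fixes g :: "'a::t2_space \<Rightarrow> ereal"
  assumes "lsc_fun g" "0 < t"
  shows "lsc_fun (\<lambda>y. ereal t * g y)"
  unfolding lsc_fun_def
proof
  fix x
  show "ereal t * g x \<le> Liminf (at x) (\<lambda>y. ereal t * g y)"
  proof (cases "at x = bot")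
    case False
    have "ereal t * g x \<le> ereal t * Liminf (at x) g"
      using assms by (intro ereal_mult_left_mono) (auto simp: lsc_fun_def)
    then show ?thesis
      using assms False by (simp add: Liminf_ereal_mult_left)
  qed simp
qed

text \<open>
  On the unit ball around \<open>y0\<close> the function is bounded below by compactness. A point outside is
  joined to \<open>y0\<close> by a segment that crosses the sphere, and convexity along the segment carries
  the bound outwards at a linear rate. This replaces the affine minorant obtained from
  separation theorems.
\<close>

lemma convex_lsc_linear_lower_bound:
  fixes g :: "'a::euclidean_space \<Rightarrow> ereal"
  assumes ninf: "\<And>z. g z \<noteq> -\<infinity>" and conv: "econvex_fun g" and lsc: "lsc_fun g" and "g y0 < \<infinity>"
  shows "\<exists>C m. 0 \<le> C \<and> (\<forall>y. ereal (m - C * norm (y - y0)) \<le> g y)"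
proof -
  obtain a where a: "g y0 = ereal a" using assms(4) ninf[of y0] by (cases "g y0") auto
  obtain b where b: "b \<in> cball y0 1" "\<And>y. y \<in> cball y0 1 \<Longrightarrow> g b \<le> g y"
    using lsc_plus_continuous_attains_inf_compact[OF lsc, of "\<lambda>_. 0" "cball y0 1"] by auto
  have "g b \<le> ereal a" using b(2)[of y0] a by simp
  then obtain m where m: "g b = ereal m" "m \<le> a" using ninf[of b] by (cases "g b") auto
  have "ereal (m - (a - m) * norm (y - y0)) \<le> g y" for y
  proof (cases "y \<in> cball y0 1")
    case True
    have "ereal (m - (a - m) * norm (y - y0)) \<le> ereal m" using m(2) by simp
    also have "\<dots> \<le> g y" using b(2)[OF True] m(1) by simp
    finally show ?thesis .
  next
    case False
    define r where "r = norm (y - y0)"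
    have r: "1 < r" using False by (simp add: r_def dist_norm norm_minus_commute)
    \<comment> \<open>The point where the segment from \<open>y0\<close> to \<open>y\<close> leaves the unit ball.\<close>
    define s where "s = (1 - 1/r) *\<^sub>R y0 + (1/r) *\<^sub>R y"
    have "s - y0 = (1/r) *\<^sub>R (y - y0)" by (simp add: s_def algebra_simps)
    moreover have "y \<noteq> y0" using r by (auto simp: r_def)
    ultimately have "norm (s - y0) = 1" by (simp add: r_def)
    then have "g b \<le> g s" by (intro b(2)) (simp add: dist_norm norm_minus_commute)
    also have "g s \<le> ereal (1 - 1/r) * g y0 + ereal (1/r) * g y"
      using conv r unfolding econvex_fun_def s_def by simp
    finally have le: "ereal m \<le> ereal (1 - 1/r) * ereal a + ereal (1/r) * g y"
      using m a by simp
    show ?thesis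
    proof (cases "g y")
      case (real t)
      then have "m \<le> (1 - 1/r) * a + (1/r) * t" using le by simp
      then have "m * r \<le> (r - 1) * a + t" using r by (simp add: field_simps)
      then have "m - (a - m) * r \<le> t" using m(2) by (simp add: algebra_simps)
      then show ?thesis using real by (simp add: r_def)
    qed (use ninf in auto)
  qed
  then show ?thesis using m(2) by (intro exI[of _ "a - m"] exI[of _ m]) auto
qed

text \<open>
  The quadratic outgrows the linear lower bound on \<open>g\<close>, so beyond some radius \<open>R\<close> the objective exceeds
  its value at a point \<open>y0\<close> of the domain, and a minimum over a ball is global.
\<close>

lemma prox_is_minimizer:
  fixes g :: "'a::euclidean_space \<Rightarrow> ereal"
  assumes proper: "proper_fun g" and conv: "econvex_fun g" and lsc: "lsc_fun g"
  shows "g (prox g x) + ereal ((1/2) * (norm (prox g x - x))\<^sup>2) \<le> g y + ereal ((1/2) * (norm (y - x))\<^sup>2)"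
proof -
  let ?q = "\<lambda>y. (1/2) * (norm (y - x))\<^sup>2"
  let ?f = "\<lambda>y. g y + ereal (?q y)"
  have ninf: "g z \<noteq> -\<infinity>" for z using proper by (auto simp: proper_fun_def)
  obtain y0 where "g y0 < \<infinity>" using proper by (auto simp: proper_fun_def edom_def)
  then obtain a where a: "g y0 = ereal a" using ninf[of y0] by (cases "g y0") auto
  obtain C m where C: "0 \<le> C" "\<And>y. ereal (m - C * norm (y - y0)) \<le> g y"
    using convex_lsc_linear_lower_bound[OF ninf conv lsc \<open>g y0 < \<infinity>\<close>] by metis
  define d where "d = norm (y0 - x)"
  \<comment> \<open>At distance \<open>r > R\<close> from \<open>y0\<close> one has \<open>r / 2 - d - C \<ge> 1\<close> and \<open>r \<ge> a - m\<close>, which beats the linear bound.\<close>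
  define R where "R = 2 * (d + C + 1) + \<bar>a - m\<bar>"
  have "0 \<le> d" by (simp add: d_def)
  then have R: "0 \<le> R" "\<bar>a - m\<bar> \<le> R" using C(1) by (simp_all add: R_def)
  have far: "?f y0 \<le> ?f y" if "y \<notin> cball y0 R" for y
  proof -
    define r where "r = norm (y - y0)"
    have r: "R < r" using that by (simp add: r_def dist_norm norm_minus_commute)
    have "r - d \<le> norm (y - x)"
      using norm_triangle_ineq[of "y - x" "x - y0"] by (simp add: r_def d_def norm_minus_commute)
    moreover have d: "0 \<le> d" by (simp add: d_def)
    moreover have "0 \<le> r - d" using r C(1) d by (simp add: R_def)
    ultimately have q: "(1/2) * (r - d)\<^sup>2 \<le> ?q y" by (simp add: power_mono)
    have "\<bar>a - m\<bar> \<le> r * 1" using r R by simp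
    also have "r * 1 \<le> r * (r / 2 - d - C)"
    proof (rule mult_left_mono)
      show "1 \<le> r / 2 - d - C" using r by (simp add: R_def field_simps)
      show "0 \<le> r" using r R by linarith
    qed
    finally have "a - m \<le> r * (r / 2 - d - C)" by linarith
    then have "a + (1/2) * d\<^sup>2 \<le> m - C * r + (1/2) * (r - d)\<^sup>2"
      by (simp add: power2_eq_square algebra_simps)
    then have "?f y0 \<le> ereal (m - C * r) + ereal ((1/2) * (r - d)\<^sup>2)"
      by (simp add: a d_def)
    also have "\<dots> \<le> ?f y"
      using C(2)[of y] q by (intro add_mono) (auto simp: r_def)
    finally show ?thesis .
  qed
  obtain b where b: "b \<in> cball y0 R" "\<And>y. y \<in> cball y0 R \<Longrightarrow> ?f b \<le> ?f y"
  proof (rule lsc_plus_continuous_attains_inf_compact[OF lsc, of ?q "cball y0 R"])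
    show "continuous_on UNIV ?q" by (intro continuous_intros)
  qed (use R in simp_all)
  have "?f b \<le> ?f y" for y
  proof (cases "y \<in> cball y0 R")
    case False
    have "?f b \<le> ?f y0" by (rule b(2)) (use R in simp)
    then show ?thesis using far[OF False] by (rule order_trans)
  qed (rule b(2))
  then have "is_arg_min ?f (\<lambda>_. True) b" by (simp add: is_arg_min_linorder)
  then have "is_arg_min ?f (\<lambda>_. True) (prox g x)"
    unfolding prox_def arg_min_def by (rule someI)
  then show ?thesis by (simp add: is_arg_min_linorder)
qed

lemma prox_in_edom:
  assumes "proper_fun g" "econvex_fun g" "lsc_fun g"
  shows "prox g x \<in> edom g"
proof -
  obtain y where "g y < \<infinity>" using assms(1) by (auto simp: proper_fun_def edom_def)
  then show ?thesis
    using prox_is_minimizer[OF assms, of x y] by (cases "g (prox g x)") (auto simp: edom_def)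
qed

text \<open>
  Moving from the minimiser towards \<open>y\<close> by a fraction \<open>t\<close> cannot decrease the objective. By
  convexity the change is at most \<open>t\<close> times the right minus the left side of the claim, plus a term of order
  \<open>t\<^sup>2\<close>; divide by \<open>t\<close> and let it tend to 0.
\<close>

lemma prox_variational_inequality:
  assumes "proper_fun g" "econvex_fun g" "lsc_fun g"
  shows "g (prox g x) + ereal ((x - prox g x) \<bullet> (y - prox g x)) \<le> g y"
proof (cases "g y")
  case (real b)
  define p where "p = prox g x"
  have "g p \<noteq> -\<infinity>" using assms(1) by (simp add: proper_fun_def)
  then obtain a where a: "g p = ereal a"
    using prox_in_edom[OF assms, of x] by (cases "g p") (auto simp: edom_def p_def)
  have "a + (x - p) \<bullet> (y - p) - b \<le> t * ((1/2) * (norm (y - p))\<^sup>2)" if t: "0 < t" "t \<le> 1" for t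
  proof -
    have "g p + ereal ((1/2) * (norm (p - x))\<^sup>2)
      \<le> g ((1 - t) *\<^sub>R p + t *\<^sub>R y) + ereal ((1/2) * (norm ((1 - t) *\<^sub>R p + t *\<^sub>R y - x))\<^sup>2)"
      unfolding p_def by (rule prox_is_minimizer[OF assms])
    also have "\<dots> \<le> (ereal (1 - t) * g p + ereal t * g y)
        + ereal ((1/2) * (norm ((1 - t) *\<^sub>R p + t *\<^sub>R y - x))\<^sup>2)"
      using assms(2) t by (intro add_mono) (auto simp: econvex_fun_def)
    finally have "a + (1/2) * (norm (p - x))\<^sup>2
      \<le> (1 - t) * a + t * b + (1/2) * (norm ((1 - t) *\<^sub>R p + t *\<^sub>R y - x))\<^sup>2"
      by (simp add: a real)
    also have "(1 - t) *\<^sub>R p + t *\<^sub>R y - x = (p - x) + t *\<^sub>R (y - p)"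
      by (simp add: algebra_simps)
    also have "(norm \<dots>)\<^sup>2 = (norm (p - x))\<^sup>2 + 2 * t * ((p - x) \<bullet> (y - p)) + t\<^sup>2 * (norm (y - p))\<^sup>2"
      by (simp only: power2_norm_eq_inner)
        (simp add: inner_add_left inner_add_right inner_commute power2_eq_square algebra_simps)
    finally have "t * (a - (p - x) \<bullet> (y - p) - b) \<le> t * (t * ((1/2) * (norm (y - p))\<^sup>2))"
      by (simp add: algebra_simps power2_eq_square)
    then show ?thesis using t by (simp add: inner_diff_left)
  qed
  then have *: "eventually (\<lambda>t. a + (x - p) \<bullet> (y - p) - b \<le> t * ((1/2) * (norm (y - p))\<^sup>2)) (at_right 0)"
    by (auto simp: eventually_at_right_field intro!: exI[of _ 1])
  have "((\<lambda>t. t * ((1/2) * (norm (y - p))\<^sup>2)) \<longlongrightarrow> 0 * ((1/2) * (norm (y - p))\<^sup>2)) (at_right 0)"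
    by (intro tendsto_intros)
  from tendsto_lowerbound[OF this *]
  have "a + (x - p) \<bullet> (y - p) - b \<le> 0" by simp
  then show ?thesis using a real by (simp add: p_def)
next
  case MInf
  then show ?thesis using assms(1) by (simp add: proper_fun_def)
qed simp

lemma prox_nonexpansive:
  assumes "proper_fun g" "econvex_fun g" "lsc_fun g"
  shows "norm (prox g x - prox g y) \<le> norm (x - y)"
proof -
  let ?p = "prox g x" and ?q = "prox g y"
  have fin: "\<bar>g (prox g u)\<bar> \<noteq> \<infinity>" for u
    using assms prox_in_edom[OF assms, of u] by (auto simp: proper_fun_def edom_def)
  obtain a b where ab: "g ?p = ereal a" "g ?q = ereal b"
    using fin by (metis ereal_real')
  have "a + (x - ?p) \<bullet> (?q - ?p) \<le> b" "b + (y - ?q) \<bullet> (?p - ?q) \<le> a"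
    using prox_variational_inequality[OF assms, of x ?q] prox_variational_inequality[OF assms, of y ?p]
    by (simp_all add: ab)
  then have "(norm (?p - ?q))\<^sup>2 \<le> (x - y) \<bullet> (?p - ?q)"
    by (simp add: power2_norm_eq_inner inner_diff_left inner_diff_right inner_commute)
  also have "\<dots> \<le> norm (x - y) * norm (?p - ?q)" by (rule norm_cauchy_schwarz)
  finally show ?thesis
    by (cases "norm (?p - ?q) = 0") (auto simp: power2_eq_square)
qed

lemma continuous_on_prox:
  assumes "proper_fun g" "econvex_fun g" "lsc_fun g"
  shows "continuous_on UNIV (prox g)"
proof -
  have "1-lipschitz_on UNIV (prox g)"
    using prox_nonexpansive[OF assms] by (auto simp: lipschitz_on_def dist_norm)
  then show ?thesis by (rule lipschitz_on_continuous_on)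
qed

section \<open>Cluster points of sequences of proximal steps\<close>

text \<open>
  Opial's argument: pick a cluster point \<open>l\<close>. If \<open>d\<close> is close to \<open>l\<close>, the limit of the
  distances to \<open>d\<close>, computed along the subsequence, is small, so the whole sequence ends up near \<open>l\<close>.
\<close>

lemma convergent_of_convergent_distances:
  fixes u :: "nat \<Rightarrow> 'a::euclidean_space"
  assumes "D \<subseteq> S" "S \<subseteq> closure D" "S \<noteq> {}"
    and conv: "\<And>d. d \<in> D \<Longrightarrow> convergent (\<lambda>k. norm (u k - d))"
    and cluster: "\<And>l r. strict_mono r \<Longrightarrow> (u \<circ> r) \<longlonglongrightarrow> l \<Longrightarrow> l \<in> S"
  shows "\<exists>l\<in>S. u \<longlonglongrightarrow> l"
proof -
  obtain d0 where d0: "d0 \<in> D" using assms(2,3) by (cases "D = {}") auto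
  obtain B where B: "\<And>k. norm (u k - d0) \<le> B"
    using convergent_imp_Bseq[OF conv[OF d0]] by (auto simp: Bseq_def)
  then have "bounded (range u)"
    by (intro boundedI[of _ "B + norm d0"]) (auto, smt (verit) norm_triangle_sub)
  then obtain l r where r: "strict_mono r" "(u \<circ> r) \<longlonglongrightarrow> l"
    using bounded_imp_convergent_subsequence by blast
  have l: "l \<in> S" by (rule cluster[OF r])
  have "u \<longlonglongrightarrow> l"
  proof (rule metric_LIMSEQ_I)
    fix e :: real assume "0 < e"
    then obtain d where d: "d \<in> D" "dist d l < e / 2"
      using assms(2) l by (meson closure_approachable half_gt_zero subsetD)
    obtain c where c: "(\<lambda>k. norm (u k - d)) \<longlonglongrightarrow> c"
      using conv[OF d(1)] by (auto simp: convergent_def)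
    have "(\<lambda>k. norm ((u \<circ> r) k - d)) \<longlonglongrightarrow> norm (l - d)"
      by (intro tendsto_intros r)
    moreover have "(\<lambda>k. norm ((u \<circ> r) k - d)) \<longlonglongrightarrow> c"
      using LIMSEQ_subseq_LIMSEQ[OF c r(1)] by (simp add: o_def)
    ultimately have "c = norm (l - d)" by (rule LIMSEQ_unique[symmetric])
    then have "c < e / 2" using d(2) by (simp add: dist_norm norm_minus_commute)
    then obtain K where K: "\<And>k. K \<le> k \<Longrightarrow> norm (u k - d) < e / 2"
      using order_tendstoD(2)[OF c, of "e / 2"] unfolding eventually_sequentially by blast
    have "dist (u k) l < e" if "K \<le> k" for k
      using K[OF that] d(2) dist_triangle[of "u k" l d] by (simp add: dist_norm)
    then show "\<exists>K. \<forall>k\<ge>K. dist (u k) l < e" by blast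
  qed
  then show ?thesis using l by blast
qed

text \<open>
  In the limit of the variational inequality of the proximal map the displacement \<open>b j - h j\<close>
  vanishes and only \<open>F\<close> remains; lower semicontinuity handles \<open>g (h j)\<close>.
\<close>

lemma limit_of_prox_steps_in_VI_Sol:
  fixes g :: "'a::euclidean_space \<Rightarrow> ereal"
  assumes g: "proper_fun g" "econvex_fun g" "lsc_fun g" and "0 < \<tau>"
    and F: "continuous_on UNIV F"
    and lim: "h \<longlonglongrightarrow> l" "b \<longlonglongrightarrow> l" "w \<longlonglongrightarrow> l"
    and step: "\<And>j. h j = prox (\<lambda>y. ereal \<tau> * g y) (b j - \<tau> *\<^sub>R F (w j))"
  shows "l \<in> VI_Sol F g"
proof -
  have ninf: "g y \<noteq> -\<infinity>" for y using g by (auto simp: proper_fun_def)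
  note tg = proper_fun_scale[OF g(1) \<open>0 < \<tau>\<close>] econvex_fun_scale[OF g(2) \<open>0 < \<tau>\<close> ninf]
    lsc_fun_scale[OF g(3) \<open>0 < \<tau>\<close>]
  have Fw: "(\<lambda>j. F (w j)) \<longlonglongrightarrow> F l"
    by (rule continuous_on_tendsto_compose[OF F lim(3)]) auto
  have main: "g l \<le> ereal (c + F l \<bullet> (y - l))" if c: "g y = ereal c" for y c
  proof -
    have "ereal \<tau> * g l \<le> ereal (\<tau> * c - (l - \<tau> *\<^sub>R F l - l) \<bullet> (y - l))"
    proof (rule lsc_fun_le_of_tendsto[OF tg(3) lim(1)])
      show "(\<lambda>j. \<tau> * c - (b j - \<tau> *\<^sub>R F (w j) - h j) \<bullet> (y - h j))
        \<longlonglongrightarrow> \<tau> * c - (l - \<tau> *\<^sub>R F l - l) \<bullet> (y - l)"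
        by (intro tendsto_intros lim Fw)
      fix j
      have "ereal \<tau> * g (h j) + ereal ((b j - \<tau> *\<^sub>R F (w j) - h j) \<bullet> (y - h j)) \<le> ereal \<tau> * g y"
        unfolding step[of j] by (rule prox_variational_inequality[OF tg])
      then show "ereal \<tau> * g (h j) \<le> ereal (\<tau> * c - (b j - \<tau> *\<^sub>R F (w j) - h j) \<bullet> (y - h j))"
        using c by (cases "ereal \<tau> * g (h j)") auto
    qed
    also have "\<tau> * c - (l - \<tau> *\<^sub>R F l - l) \<bullet> (y - l) = \<tau> * (c + F l \<bullet> (y - l))"
      by (simp add: algebra_simps)
    finally show ?thesis
      using \<open>0 < \<tau>\<close> ninf[of l] by (cases "g l") auto
  qed
  obtain y0 where "g y0 < \<infinity>" using g(1) by (auto simp: proper_fun_def edom_def)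
  then obtain c0 where "g y0 = ereal c0" using ninf[of y0] by (cases "g y0") auto
  from main[OF this] obtain a where a: "g l = ereal a"
    using ninf[of l] by (cases "g l") auto
  show ?thesis
    unfolding VI_Sol_def
  proof (intro CollectI allI)
    fix y
    show "0 \<le> ereal (F l \<bullet> (y - l)) + g y - g l"
      using main[of y] ninf[of y] a by (cases "g y") auto
  qed
qed

section \<open>Measurability and mean of the stochastic oracle\<close>

text \<open>
  Rounding the second argument to finitely many values gives measurable functions, which
  converge pointwise by continuity.
\<close>

lemma borel_measurable_Caratheodory:
  fixes f :: "'x \<Rightarrow> 'a::{metric_space, second_countable_topology} \<Rightarrow> 'b::metric_space"
  assumes meas: "\<And>u. (\<lambda>x. f x u) \<in> borel_measurable Q"
    and cont: "\<And>x. x \<in> space Q \<Longrightarrow> continuous_on UNIV (f x)"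
  shows "(\<lambda>(x, u). f x u) \<in> borel_measurable (Q \<Otimes>\<^sub>M borel)"
proof -
  obtain s :: "nat \<Rightarrow> 'a \<Rightarrow> 'a" where s: "\<And>i. simple_function borel (s i)" "\<And>u. (\<lambda>i. s i u) \<longlonglongrightarrow> u"
    using borel_measurable_implies_sequence_metric[of "\<lambda>u. u" "borel :: 'a measure"] by simp metis
  show ?thesis
  proof (rule borel_measurable_LIMSEQ_metric[where f = "\<lambda>i (x, u). f x (s i u)"])
    fix i
    have m1: "(\<lambda>xu. s i (snd xu)) \<in> measurable (Q \<Otimes>\<^sub>M borel) (count_space (range (s i)))"
      using measurable_simple_function[OF s(1)[of i]] s(1)[of i]
      by (intro measurable_compose[OF measurable_snd])
        (auto intro!: measurable_count_space_extend simp: simple_function_def measurable_def)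
    have m2: "(\<lambda>xu. f (fst xu) d) \<in> borel_measurable (Q \<Otimes>\<^sub>M borel)" for d
      by (rule measurable_compose[OF measurable_fst meas])
    have m3: "countable (range (s i))"
      using s(1)[of i] by (auto simp: simple_function_def intro: countable_finite)
    show "(\<lambda>(x, u). f x (s i u)) \<in> borel_measurable (Q \<Otimes>\<^sub>M borel)"
      using measurable_compose_countable'[of "range (s i)" "\<lambda>d xu. f (fst xu) d", OF m2 m1 m3]
      by (simp add: case_prod_beta')
  next
    fix xu assume "xu \<in> space (Q \<Otimes>\<^sub>M (borel :: 'a measure))"
    then obtain x u where "xu = (x, u)" "x \<in> space Q" by (auto simp: space_pair_measure)
    then show "(\<lambda>i. case xu of (x, u) \<Rightarrow> f x (s i u)) \<longlonglongrightarrow> (case xu of (x, u) \<Rightarrow> f x u)"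
      using continuous_on_tendsto_compose[OF cont s(2)] by simp
  qed
qed

text \<open>
  The mean of the norm is at most the root of the mean of its square. For \<open>s\<close> the claimed bound,
  this is obtained from \<open>t \<le> (t\<^sup>2 / s + s) / 2\<close>.
\<close>

lemma lipschitz_of_lipschitz_in_mean:
  assumes "prob_space Q" "unbiased_oracle Q Fo F" "0 < L" "lipschitz_in_mean Q Fo L"
  shows "norm (F u - F v) \<le> L * norm (u - v)"
proof (cases "u = v")
  case False
  interpret prob_space Q by fact
  define s where "s = L * norm (u - v)"
  have s: "0 < s" using False assms(3) by (simp add: s_def)
  have int: "integrable Q (\<lambda>x. Fo x u)" "integrable Q (\<lambda>x. Fo x v)"
    and F: "F u = (\<integral>x. Fo x u \<partial>Q)" "F v = (\<integral>x. Fo x v \<partial>Q)"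
    using assms(2) by (auto simp: unbiased_oracle_def)
  let ?n = "\<lambda>x. norm (Fo x u - Fo x v)"
  have n: "integrable Q ?n" using int by auto
  have fin: "(\<integral>\<^sup>+x. ennreal ((?n x)\<^sup>2) \<partial>Q) \<le> ennreal (s\<^sup>2)"
    using assms(4) by (auto simp: lipschitz_in_mean_def s_def power_mult_distrib)
  have [measurable]: "(\<lambda>x. Fo x u) \<in> borel_measurable Q" "(\<lambda>x. Fo x v) \<in> borel_measurable Q"
    using int by auto
  have n2: "integrable Q (\<lambda>x. (?n x)\<^sup>2)"
    using fin by (intro integrableI_nonneg) (auto simp: top_unique less_top[symmetric] intro: le_less_trans)
  have "ennreal (\<integral>x. (?n x)\<^sup>2 \<partial>Q) \<le> ennreal (s\<^sup>2)"
    using fin n2 by (simp add: nn_integral_eq_integral)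
  then have second: "(\<integral>x. (?n x)\<^sup>2 \<partial>Q) \<le> s\<^sup>2"
    by (simp add: ennreal_le_iff)
  have "norm (F u - F v) = norm (\<integral>x. Fo x u - Fo x v \<partial>Q)"
    using int by (simp add: F)
  also have "\<dots> \<le> (\<integral>x. ?n x \<partial>Q)" by (rule integral_norm_bound)
  also have "\<dots> \<le> (\<integral>x. ((?n x)\<^sup>2 / s + s) / 2 \<partial>Q)"
  proof (rule integral_mono[OF n])
    show "integrable Q (\<lambda>x. ((?n x)\<^sup>2 / s + s) / 2)" using n2 by simp
    fix x
    have "0 \<le> (?n x - s)\<^sup>2 / s" using s by simp
    also have "\<dots> = (?n x)\<^sup>2 / s + s - 2 * ?n x"
      using s by (simp add: power2_eq_square field_simps)
    finally show "?n x \<le> ((?n x)\<^sup>2 / s + s) / 2" by simp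
  qed
  also have "\<dots> = ((\<integral>x. (?n x)\<^sup>2 \<partial>Q) / s + s) / 2"
    using n2 by (simp add: prob_space)
  also have "\<dots> \<le> (s\<^sup>2 / s + s) / 2"
    using second s by (intro divide_right_mono add_right_mono) auto
  also have "\<dots> = s" using s by (simp add: power2_eq_square)
  finally show ?thesis by (simp add: s_def)
qed simp

section \<open>Mean descent in one step\<close>

locale extragradient_setting =
  fixes g :: "'a::euclidean_space \<Rightarrow> ereal"
    and F :: "'a \<Rightarrow> 'a"
    and Fo :: "'x \<Rightarrow> 'a \<Rightarrow> 'a"
    and Q :: "'x measure"
    and L \<alpha> p \<tau> \<gamma> :: real
  assumes proper: "proper_fun g" and convex: "econvex_fun g" and lsc: "lsc_fun g"
    and monotone: "monotone_operator_on (edom g) F"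
    and prob_Q: "prob_space Q"
    and unbiased: "unbiased_oracle Q Fo F"
    and L_pos: "L > 0" and lipschitz: "lipschitz_in_mean Q Fo L"
    and cont_Fo: "\<forall>x\<in>space Q. continuous_on UNIV (Fo x)"
    and \<alpha>: "0 \<le> \<alpha>" "\<alpha> < 1"
    and p: "0 < p" "p \<le> 1"
    and \<gamma>: "0 < \<gamma>" "\<gamma> < 1"
    and \<tau>_eq: "\<tau> = sqrt (1 - \<alpha>) / L * \<gamma>"
begin

definition proximal_step :: "'a \<Rightarrow> 'a" where
  "proximal_step = prox (\<lambda>y. ereal \<tau> * g y)"

definition anchor :: "'a \<Rightarrow> 'a \<Rightarrow> 'a" where
  "anchor z w = \<alpha> *\<^sub>R z + (1 - \<alpha>) *\<^sub>R w"

definition half_step :: "'a \<Rightarrow> 'a \<Rightarrow> 'a" where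
  "half_step z w = proximal_step (anchor z w - \<tau> *\<^sub>R F w)"

definition full_step :: "'a \<Rightarrow> 'a \<Rightarrow> 'x \<Rightarrow> 'a" where
  "full_step z w x = proximal_step (anchor z w - \<tau> *\<^sub>R (F w + Fo x (half_step z w) - Fo x w))"

definition lyapunov :: "'a \<Rightarrow> 'a \<Rightarrow> 'a \<Rightarrow> real" where
  "lyapunov s z w = \<alpha> * (norm (z - s))\<^sup>2 + (1 - \<alpha>) / p * (norm (w - s))\<^sup>2"

text \<open>
  In one step the Lyapunov function of any solution loses, in mean, at least the mean of this
  over the sample \<open>x\<close>.
\<close>

definition decrease :: "'a \<Rightarrow> 'a \<Rightarrow> 'x \<Rightarrow> real" where
  "decrease z w x = (1 - \<gamma>) * (norm (full_step z w x - half_step z w))\<^sup>2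
     + (1 - \<gamma>) * (1 - \<alpha>) * (norm (half_step z w - w))\<^sup>2"

lemma \<tau>_pos: "0 < \<tau>"
  using \<alpha> \<gamma> L_pos by (simp add: \<tau>_eq)

text \<open>
  The step size is chosen for this identity: up to the factor \<open>\<gamma>\<close>, it lets Young's inequality turn the
  Lipschitz constant of the oracle into the weight \<open>1 - \<alpha>\<close> of the snapshot.
\<close>

lemma \<tau>_square: "\<tau>\<^sup>2 * L\<^sup>2 = (1 - \<alpha>) * \<gamma>\<^sup>2"
  using \<alpha> L_pos by (simp add: \<tau>_eq power_mult_distrib power_divide)

lemma lyapunov_nonneg: "0 \<le> lyapunov s z w"
  using \<alpha> p by (auto simp: lyapunov_def intro!: add_nonneg_nonneg mult_nonneg_nonneg)

lemma decrease_nonneg: "0 \<le> decrease z w x"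
  using \<alpha> \<gamma> by (auto simp: decrease_def intro!: add_nonneg_nonneg mult_nonneg_nonneg)

lemma g_not_MInfty: "g y \<noteq> -\<infinity>"
  using proper by (simp add: proper_fun_def)

lemma scaled_g:
  "proper_fun (\<lambda>y. ereal \<tau> * g y)" "econvex_fun (\<lambda>y. ereal \<tau> * g y)" "lsc_fun (\<lambda>y. ereal \<tau> * g y)"
  using proper_fun_scale[OF proper \<tau>_pos] econvex_fun_scale[OF convex \<tau>_pos g_not_MInfty]
    lsc_fun_scale[OF lsc \<tau>_pos] by auto

lemma g_proximal_step_finite: "\<exists>a. g (proximal_step v) = ereal a"
  using prox_in_edom[OF scaled_g, of v] g_not_MInfty[of "proximal_step v"] \<tau>_pos
  by (cases "g (proximal_step v)") (auto simp: edom_def proximal_step_def)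

lemma proximal_step_inequality:
  assumes "g (proximal_step v) = ereal a" "g y = ereal b"
  shows "\<tau> * a + (v - proximal_step v) \<bullet> (y - proximal_step v) \<le> \<tau> * b"
  using prox_variational_inequality[OF scaled_g, of v y] assms by (simp add: proximal_step_def)

text \<open>
  A solution lies in the domain of \<open>g\<close>: at infinite \<open>g s\<close> the inequality fails for any point of the domain.
\<close>

lemma solution_finite:
  assumes "s \<in> VI_Sol F g"
  shows "\<exists>c. g s = ereal c"
proof -
  obtain y where "g y < \<infinity>" using proper by (auto simp: proper_fun_def edom_def)
  moreover have "0 \<le> ereal (F s \<bullet> (y - s)) + g y - g s"
    using assms by (auto simp: VI_Sol_def)
  ultimately show ?thesis
    using g_not_MInfty[of s] g_not_MInfty[of y] by (cases "g s"; cases "g y") auto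
qed

text \<open>
  Monotonicity moves the operator from the solution \<open>s\<close> to the test point \<open>h\<close>, where the algorithm evaluates it.
\<close>

lemma solution_inequality:
  assumes s: "s \<in> VI_Sol F g" and "g s = ereal c" "g h = ereal b"
  shows "F h \<bullet> (s - h) + c - b \<le> 0"
proof -
  have "0 \<le> ereal (F s \<bullet> (h - s)) + g h - g s"
    using s by (auto simp: VI_Sol_def)
  then have "0 \<le> F s \<bullet> (h - s) + b - c" using assms by simp
  moreover have "0 \<le> (F h - F s) \<bullet> (h - s)"
    using monotone assms by (auto simp: monotone_operator_on_def edom_def)
  ultimately show ?thesis
    by (simp add: inner_diff_left inner_diff_right)
qed

lemma young_inequality:
  "2 * \<tau> * (d \<bullet> e) \<le> \<tau>\<^sup>2 / \<gamma> * (norm d)\<^sup>2 + \<gamma> * (norm (e :: 'a))\<^sup>2"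
proof -
  have "0 \<le> (norm (\<tau> *\<^sub>R d - \<gamma> *\<^sub>R e))\<^sup>2 / \<gamma>" using \<gamma> by simp
  also have "(norm (\<tau> *\<^sub>R d - \<gamma> *\<^sub>R e))\<^sup>2 = \<tau>\<^sup>2 * (norm d)\<^sup>2 - 2 * \<tau> * \<gamma> * (d \<bullet> e) + \<gamma>\<^sup>2 * (norm e)\<^sup>2"
    by (simp only: power2_norm_eq_inner)
      (simp add: inner_diff_left inner_diff_right inner_commute power2_eq_square algebra_simps)
  also have "\<dots> / \<gamma> = \<tau>\<^sup>2 / \<gamma> * (norm d)\<^sup>2 - 2 * \<tau> * (d \<bullet> e) + \<gamma> * (norm e)\<^sup>2"
    using \<gamma> by (simp add: field_simps power2_eq_square)
  finally show ?thesis by simp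
qed

text \<open>
  The scalar products from the two proximal inequalities, with all points measured from the solution:
  \<open>A\<close>, \<open>B\<close>, \<open>H\<close>, \<open>X\<close> stand for the iterate, the snapshot, the half step and the full
  step, \<open>U\<close> for \<open>F\<close> at the snapshot and \<open>D\<close> for the oracle difference.
\<close>

lemma energy_identity:
  fixes A B H X U D :: 'a
  shows "2 * ((\<alpha> *\<^sub>R A + (1 - \<alpha>) *\<^sub>R B - \<tau> *\<^sub>R (U + D) - X) \<bullet> (- X))
     + 2 * ((\<alpha> *\<^sub>R A + (1 - \<alpha>) *\<^sub>R B - \<tau> *\<^sub>R U - H) \<bullet> (X - H))
   = (norm X)\<^sup>2 + (norm (X - H))\<^sup>2 + \<alpha> * (norm (H - A))\<^sup>2 + (1 - \<alpha>) * (norm (H - B))\<^sup>2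
     - \<alpha> * (norm A)\<^sup>2 - (1 - \<alpha>) * (norm B)\<^sup>2 + 2 * \<tau> * ((U + D) \<bullet> H) + 2 * \<tau> * (D \<bullet> (X - H))"
  by (simp only: power2_norm_eq_inner)
    (simp add: inner_diff_left inner_diff_right inner_add_left inner_add_right inner_commute algebra_simps)

abbreviation oracle_diff :: "'a \<Rightarrow> 'a \<Rightarrow> 'x \<Rightarrow> 'a" where
  "oracle_diff z w x \<equiv> Fo x (half_step z w) - Fo x w"

text \<open>
  Twice the sum of the proximal inequalities, expanded by \<open>energy_identity\<close>; Young's
  inequality bounds the scalar product of the oracle difference with the move from the half to the full step,
  at the price of a fraction \<open>\<gamma>\<close> of the squared length of that move.
  The last summand vanishes on average, since the half step does not depend on the sample.
\<close>

lemma pathwise_descent: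
  assumes s: "s \<in> VI_Sol F g"
  shows "(norm (full_step z w x - s))\<^sup>2 + decrease z w x
    \<le> \<alpha> * (norm (z - s))\<^sup>2 + (1 - \<alpha>) * (norm (w - s))\<^sup>2 - (1 - \<alpha>) * \<gamma> * (norm (half_step z w - w))\<^sup>2
      + \<tau>\<^sup>2 / \<gamma> * (norm (oracle_diff z w x))\<^sup>2
      - 2 * \<tau> * ((F w + oracle_diff z w x - F (half_step z w)) \<bullet> (half_step z w - s))"
proof -
  define h f D where "h = half_step z w" and "f = full_step z w x" and "D = Fo x h - Fo x w"
  obtain a where a: "g f = ereal a" using g_proximal_step_finite by (auto simp: f_def full_step_def)
  obtain b where b: "g h = ereal b" using g_proximal_step_finite by (auto simp: h_def half_step_def)
  obtain c where c: "g s = ereal c" using solution_finite[OF s] by blast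
  have f: "\<tau> * a + (anchor z w - \<tau> *\<^sub>R (F w + D) - f) \<bullet> (s - f) \<le> \<tau> * c"
    using proximal_step_inequality[OF a[unfolded f_def full_step_def] c]
    by (simp add: f_def full_step_def D_def h_def add_diff_eq)
  have h: "\<tau> * b + (anchor z w - \<tau> *\<^sub>R F w - h) \<bullet> (f - h) \<le> \<tau> * a"
    using proximal_step_inequality[OF b[unfolded h_def half_step_def] a]
    by (simp add: h_def half_step_def)
  have "\<tau> * (F h \<bullet> (s - h) + c - b) \<le> \<tau> * 0"
    using solution_inequality[OF s c b] \<tau>_pos by (intro mult_left_mono) auto
  then have vi: "\<tau> * (F h \<bullet> (h - s)) + \<tau> * b - \<tau> * c \<ge> 0"
    by (simp add: algebra_simps inner_diff_right)
  have anchor: "anchor z w = \<alpha> *\<^sub>R (z - s) + (1 - \<alpha>) *\<^sub>R (w - s) + s"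
    by (simp add: anchor_def algebra_simps)
  have "2 * ((anchor z w - \<tau> *\<^sub>R (F w + D) - f) \<bullet> (s - f)) + 2 * ((anchor z w - \<tau> *\<^sub>R F w - h) \<bullet> (f - h))
    = (norm (f - s))\<^sup>2 + (norm (f - h))\<^sup>2 + \<alpha> * (norm (h - z))\<^sup>2 + (1 - \<alpha>) * (norm (h - w))\<^sup>2
     - \<alpha> * (norm (z - s))\<^sup>2 - (1 - \<alpha>) * (norm (w - s))\<^sup>2
     + 2 * \<tau> * ((F w + D) \<bullet> (h - s)) + 2 * \<tau> * (D \<bullet> (f - h))"
    using energy_identity[of "z - s" "w - s" "F w" D "f - s" "h - s"]
    by (simp add: anchor algebra_simps)
  moreover have "(F w + D) \<bullet> (h - s) = (F w + D - F h) \<bullet> (h - s) + F h \<bullet> (h - s)"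
    by (simp add: inner_diff_left)
  moreover have "- 2 * \<tau> * (D \<bullet> (f - h)) \<le> \<tau>\<^sup>2 / \<gamma> * (norm D)\<^sup>2 + \<gamma> * (norm (f - h))\<^sup>2"
    using young_inequality[of "- D" "f - h"] by simp
  moreover have "0 \<le> \<alpha> * (norm (h - z))\<^sup>2" using \<alpha> by simp
  ultimately have "(norm (f - s))\<^sup>2 + (1 - \<gamma>) * (norm (f - h))\<^sup>2 + (1 - \<alpha>) * (norm (h - w))\<^sup>2
    \<le> \<alpha> * (norm (z - s))\<^sup>2 + (1 - \<alpha>) * (norm (w - s))\<^sup>2 + \<tau>\<^sup>2 / \<gamma> * (norm D)\<^sup>2
      - 2 * \<tau> * ((F w + D - F h) \<bullet> (h - s))"
    using f h vi by (simp add: distrib_left left_diff_distrib)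
  then show ?thesis
    unfolding decrease_def h_def[symmetric] f_def[symmetric] D_def[symmetric]
    by (simp add: algebra_simps)
qed

lemma oracle_integrable: "integrable Q (\<lambda>x. Fo x u)" and oracle_mean: "(\<integral>x. Fo x u \<partial>Q) = F u"
  using unbiased by (auto simp: unbiased_oracle_def)

lemma oracle_variance:
  shows "integrable Q (\<lambda>x. (norm (Fo x u - Fo x v))\<^sup>2)"
    and "(\<integral>x. (norm (Fo x u - Fo x v))\<^sup>2 \<partial>Q) \<le> L\<^sup>2 * (norm (u - v))\<^sup>2"
proof -
  have le: "(\<integral>\<^sup>+x. ennreal ((norm (Fo x u - Fo x v))\<^sup>2) \<partial>Q) \<le> ennreal (L\<^sup>2 * (norm (u - v))\<^sup>2)"
    using lipschitz by (simp add: lipschitz_in_mean_def)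
  have [measurable]: "(\<lambda>x. Fo x u) \<in> borel_measurable Q" for u
    using oracle_integrable by auto
  show int: "integrable Q (\<lambda>x. (norm (Fo x u - Fo x v))\<^sup>2)"
    using le by (intro integrableI_nonneg) (auto intro: le_less_trans)
  show "(\<integral>x. (norm (Fo x u - Fo x v))\<^sup>2 \<partial>Q) \<le> L\<^sup>2 * (norm (u - v))\<^sup>2"
    using le int by (simp add: nn_integral_eq_integral ennreal_le_iff)
qed

text \<open>
  By the choice of \<open>\<tau>\<close> the mean of the term with the squared oracle difference is at most
  \<open>(1 - \<alpha>) * \<gamma>\<close> times the squared distance from the snapshot to the half step, which
  \<open>pathwise_descent\<close> keeps in reserve.
\<close>

lemma mean_descent_over_samples:
  assumes s: "s \<in> VI_Sol F g"
  shows "(\<integral>\<^sup>+x. ennreal ((norm (full_step z w x - s))\<^sup>2 + decrease z w x) \<partial>Q)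
    \<le> ennreal (\<alpha> * (norm (z - s))\<^sup>2 + (1 - \<alpha>) * (norm (w - s))\<^sup>2)"
proof -
  interpret prob_space Q by (rule prob_Q)
  define h where "h = half_step z w"
  let ?A = "\<alpha> * (norm (z - s))\<^sup>2 + (1 - \<alpha>) * (norm (w - s))\<^sup>2"
  let ?D = "\<lambda>x. Fo x h - Fo x w"
  let ?B = "\<lambda>x. ?A - (1 - \<alpha>) * \<gamma> * (norm (h - w))\<^sup>2 + \<tau>\<^sup>2 / \<gamma> * (norm (?D x))\<^sup>2
      - 2 * \<tau> * ((F w + ?D x - F h) \<bullet> (h - s))"
  note int = oracle_integrable oracle_variance(1)[of h w]
  have B: "integrable Q ?B"
    by (intro Bochner_Integration.integrable_diff Bochner_Integration.integrable_add integrable_mult_right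
        integrable_inner_left integrable_const int)
  have mean: "(\<integral>x. (F w + ?D x - F h) \<bullet> (h - s) \<partial>Q) = 0"
    using int by (simp add: oracle_mean prob_space integral_inner_left)
  have "(\<integral>x. ?B x \<partial>Q) = ?A - (1 - \<alpha>) * \<gamma> * (norm (h - w))\<^sup>2 + \<tau>\<^sup>2 / \<gamma> * (\<integral>x. (norm (?D x))\<^sup>2 \<partial>Q)
      - 2 * \<tau> * (\<integral>x. (F w + ?D x - F h) \<bullet> (h - s) \<partial>Q)"
    using int by (simp add: prob_space)
  also have "\<dots> \<le> ?A - (1 - \<alpha>) * \<gamma> * (norm (h - w))\<^sup>2 + \<tau>\<^sup>2 / \<gamma> * (L\<^sup>2 * (norm (h - w))\<^sup>2)"
    using oracle_variance(2)[of h w] \<gamma> unfolding mean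
    by (simp add: mult_left_mono divide_right_mono)
  also have "\<tau>\<^sup>2 / \<gamma> * (L\<^sup>2 * (norm (h - w))\<^sup>2) = (\<tau>\<^sup>2 * L\<^sup>2) / \<gamma> * (norm (h - w))\<^sup>2"
    by simp
  also have "(\<tau>\<^sup>2 * L\<^sup>2) / \<gamma> = (1 - \<alpha>) * \<gamma>"
    unfolding \<tau>_square using \<gamma> by (simp add: power2_eq_square)
  finally have "(\<integral>x. ?B x \<partial>Q) \<le> ?A" by simp
  have le: "(norm (full_step z w x - s))\<^sup>2 + decrease z w x \<le> ?B x" for x
    using pathwise_descent[OF s, of z w x] by (simp add: h_def)
  have "(\<integral>\<^sup>+x. ennreal ((norm (full_step z w x - s))\<^sup>2 + decrease z w x) \<partial>Q) \<le> (\<integral>\<^sup>+x. ennreal (?B x) \<partial>Q)"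
    by (intro nn_integral_mono ennreal_leI le)
  also have "\<dots> = ennreal (\<integral>x. ?B x \<partial>Q)"
  proof (rule nn_integral_eq_integral[OF B], rule AE_I2)
    fix x
    have "0 \<le> (norm (full_step z w x - s))\<^sup>2 + decrease z w x"
      using decrease_nonneg by (simp add: add_nonneg_nonneg)
    then show "0 \<le> ?B x" using le by (rule order_trans)
  qed
  also have "\<dots> \<le> ennreal ?A" by (rule ennreal_leI) fact
  finally show ?thesis .
qed

lemma continuous_F: "continuous_on UNIV F"
proof -
  have "L-lipschitz_on UNIV F"
    using lipschitz_of_lipschitz_in_mean[OF prob_Q unbiased L_pos lipschitz] L_pos
    by (auto simp: lipschitz_on_def dist_norm)
  then show ?thesis by (rule lipschitz_on_continuous_on)
qed

lemma measurable_F[measurable]: "F \<in> borel_measurable borel"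
  by (rule borel_measurable_continuous_onI[OF continuous_F])

lemma measurable_proximal_step[measurable]: "proximal_step \<in> borel_measurable borel"
  unfolding proximal_step_def by (rule borel_measurable_continuous_onI[OF continuous_on_prox[OF scaled_g]])

lemma measurable_oracle[measurable (raw)]:
  assumes "f \<in> measurable N Q" "u \<in> borel_measurable N"
  shows "(\<lambda>y. Fo (f y) (u y)) \<in> borel_measurable N"
proof -
  have "(\<lambda>(x, u). Fo x u) \<in> borel_measurable (Q \<Otimes>\<^sub>M borel)"
    using oracle_integrable cont_Fo by (intro borel_measurable_Caratheodory) auto
  from measurable_compose[OF measurable_Pair[OF assms] this] show ?thesis by simp
qed

lemma measurable_half_step[measurable (raw)]:
  assumes [measurable]: "u \<in> borel_measurable N" "v \<in> borel_measurable N"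
  shows "(\<lambda>y. half_step (u y) (v y)) \<in> borel_measurable N"
  unfolding half_step_def anchor_def by measurable

lemma measurable_full_step[measurable (raw)]:
  assumes [measurable]: "u \<in> borel_measurable N" "v \<in> borel_measurable N" "f \<in> measurable N Q"
  shows "(\<lambda>y. full_step (u y) (v y) (f y)) \<in> borel_measurable N"
  unfolding full_step_def anchor_def by measurable

lemma measurable_lyapunov[measurable (raw)]:
  assumes [measurable]: "u \<in> borel_measurable N" "v \<in> borel_measurable N"
  shows "(\<lambda>y. lyapunov s (u y) (v y)) \<in> borel_measurable N"
  unfolding lyapunov_def by measurable

lemma measurable_decrease[measurable (raw)]:
  assumes [measurable]: "u \<in> borel_measurable N" "v \<in> borel_measurable N" "f \<in> measurable N Q"
  shows "(\<lambda>y. decrease (u y) (v y) (f y)) \<in> borel_measurable N"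
  unfolding decrease_def by measurable

text \<open>
  Averaging over the coin turns \<open>(1 - \<alpha>) / p\<close> times the snapshot's squared distance into \<open>1 - \<alpha>\<close>
  times that of the full step, plus \<open>(1 - \<alpha>) * (1 - p) / p\<close> times the old one. The first joins \<open>\<alpha>\<close> to weight 1, as
  in \<open>mean_descent_over_samples\<close>.
\<close>

lemma mean_descent:
  assumes s: "s \<in> VI_Sol F g"
  shows "(\<integral>\<^sup>+(x, c). ennreal (lyapunov s (full_step z w x) (if c then full_step z w x else w) + decrease z w x)
      \<partial>(Q \<Otimes>\<^sub>M measure_pmf (bernoulli_pmf p))) \<le> ennreal (lyapunov s z w)"
proof -
  interpret Q: prob_space Q by (rule prob_Q)
  let ?K = "(1 - \<alpha>) * (1 - p) / p * (norm (w - s))\<^sup>2"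
  let ?E = "\<lambda>x. (norm (full_step z w x - s))\<^sup>2 + decrease z w x"
  let ?f = "\<lambda>x c. lyapunov s (full_step z w x) (if c then full_step z w x else w) + decrease z w x"
  have nonneg: "0 \<le> ?f x c" for x c
    by (intro add_nonneg_nonneg lyapunov_nonneg decrease_nonneg)
  have K: "0 \<le> ?K" using \<alpha> p by simp
  have coin: "(\<integral>\<^sup>+c. ennreal (?f x c) \<partial>measure_pmf (bernoulli_pmf p)) = ennreal (?E x) + ennreal ?K" for x
  proof -
    have "(\<integral>\<^sup>+c. ennreal (?f x c) \<partial>measure_pmf (bernoulli_pmf p))
      = ennreal p * ennreal (?f x True) + ennreal (1 - p) * ennreal (?f x False)"
      using p by (simp add: nn_integral_bernoulli_pmf mult.commute)
    also have "\<dots> = ennreal (p * ?f x True + (1 - p) * ?f x False)"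
    proof -
      have "ennreal (p * u + (1 - p) * v) = ennreal p * ennreal u + ennreal (1 - p) * ennreal v"
        if "0 \<le> u" "0 \<le> v" for u v
        using p that by (simp add: ennreal_plus ennreal_mult')
      from this[OF nonneg nonneg] show ?thesis by (rule sym)
    qed
    also have "p * ?f x True + (1 - p) * ?f x False = ?E x + ?K"
      using p by (simp add: lyapunov_def field_simps)
    finally show ?thesis using K decrease_nonneg by (simp add: ennreal_plus)
  qed
  have "(\<integral>\<^sup>+(x, c). ennreal (?f x c) \<partial>(Q \<Otimes>\<^sub>M measure_pmf (bernoulli_pmf p)))
    = (\<integral>\<^sup>+x. \<integral>\<^sup>+c. ennreal (?f x c) \<partial>measure_pmf (bernoulli_pmf p) \<partial>Q)"
    by (subst measure_pmf.nn_integral_fst[symmetric]) simp_all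
  also have "\<dots> = (\<integral>\<^sup>+x. ennreal (?E x) + ennreal ?K \<partial>Q)"
    by (simp only: coin)
  also have "\<dots> = (\<integral>\<^sup>+x. ennreal (?E x) \<partial>Q) + ennreal ?K"
    by (subst nn_integral_add) (auto simp: Q.emeasure_space_1)
  also have "\<dots> \<le> ennreal (\<alpha> * (norm (z - s))\<^sup>2 + (1 - \<alpha>) * (norm (w - s))\<^sup>2) + ennreal ?K"
    by (intro add_right_mono mean_descent_over_samples s)
  also have "\<dots> = ennreal (\<alpha> * (norm (z - s))\<^sup>2 + (1 - \<alpha>) * (norm (w - s))\<^sup>2 + ?K)"
    using K \<alpha> by (intro ennreal_plus[symmetric]) auto
  also have "\<alpha> * (norm (z - s))\<^sup>2 + (1 - \<alpha>) * (norm (w - s))\<^sup>2 + ?K = lyapunov s z w"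
    using p by (simp add: lyapunov_def field_simps)
  finally show ?thesis .
qed

end

section \<open>Convergence of the trajectories\<close>

context extragradient_setting
begin

text \<open>
  Since \<open>z k - w k\<close> vanishes, convergence of the Lyapunov function is convergence of
  the snapshot's distance alone. Working with the snapshots, whose weight \<open>(1 - \<alpha>) / p\<close> is positive, covers the case
  \<open>\<alpha> = 0\<close> as well.
\<close>

lemma trajectory_converges:
  fixes z w :: "nat \<Rightarrow> 'a" and x :: "nat \<Rightarrow> 'x"
  assumes D: "D \<subseteq> VI_Sol F g" "VI_Sol F g \<subseteq> closure D" "VI_Sol F g \<noteq> {}"
    and z_step: "\<And>k. z (Suc k) = full_step (z k) (w k) (x k)"
    and w_step: "\<And>k. w (Suc k) = z (Suc k) \<or> w (Suc k) = w k"
    and energy: "\<And>d. d \<in> D \<Longrightarrow> convergent (\<lambda>k. lyapunov d (z k) (w k))"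
    and sum: "summable (\<lambda>k. decrease (z k) (w k) (x k))"
  shows "\<exists>l\<in>VI_Sol F g. z \<longlonglongrightarrow> l"
proof -
  define h where "h k = half_step (z k) (w k)" for k
  have dec: "(\<lambda>k. decrease (z k) (w k) (x k)) \<longlonglongrightarrow> 0"
    using sum by (rule summable_LIMSEQ_zero)
  have square_null: "u \<longlonglongrightarrow> 0"
    if "0 < C" "\<And>k. C * (norm (u k))\<^sup>2 \<le> decrease (z k) (w k) (x k)" for C and u :: "nat \<Rightarrow> 'a"
  proof -
    have "(\<lambda>k. C * (norm (u k))\<^sup>2) \<longlonglongrightarrow> 0"
      using that by (intro tendsto_sandwich[OF _ _ tendsto_const dec]) auto
    then have "(\<lambda>k. sqrt ((C * (norm (u k))\<^sup>2) / C)) \<longlonglongrightarrow> sqrt (0 / C)"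
      using that by (intro tendsto_intros) auto
    then show ?thesis using that by (simp add: tendsto_norm_zero_iff)
  qed
  have zh: "(\<lambda>k. z (Suc k) - h k) \<longlonglongrightarrow> 0"
    using \<gamma> \<alpha> by (intro square_null[of "1 - \<gamma>"]) (auto simp: decrease_def z_step h_def)
  have hw: "(\<lambda>k. h k - w k) \<longlonglongrightarrow> 0"
    using \<gamma> \<alpha> by (intro square_null[of "(1 - \<gamma>) * (1 - \<alpha>)"]) (auto simp: decrease_def h_def)
  have "(\<lambda>k. z (Suc k) - w k) \<longlonglongrightarrow> 0"
    using tendsto_add[OF zh hw] by simp
  then have "(\<lambda>k. z (Suc k) - w (Suc k)) \<longlonglongrightarrow> 0"
  proof (rule Lim_null_comparison[rotated, OF tendsto_norm_zero])
    show "eventually (\<lambda>k. norm (z (Suc k) - w (Suc k)) \<le> norm (z (Suc k) - w k)) sequentially"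
    proof (rule always_eventually, rule allI)
      fix k show "norm (z (Suc k) - w (Suc k)) \<le> norm (z (Suc k) - w k)"
        using w_step[of k] by auto
    qed
  qed
  then have zw: "(\<lambda>k. z k - w k) \<longlonglongrightarrow> 0"
    by (rule LIMSEQ_imp_Suc)
  have distances: "convergent (\<lambda>k. norm (w k - d))" if d: "d \<in> D" for d
  proof -
    define \<beta> where "\<beta> = (1 - \<alpha>) / p"
    have \<beta>: "0 < \<beta>" using \<alpha> p by (simp add: \<beta>_def)
    obtain e where e: "(\<lambda>k. lyapunov d (z k) (w k)) \<longlonglongrightarrow> e"
      using energy[OF d] by (auto simp: convergent_def)
    obtain B where B: "\<And>k. \<bar>lyapunov d (z k) (w k)\<bar> \<le> B"
      using convergent_imp_Bseq[OF energy[OF d]] by (auto simp: Bseq_def)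
    define C where "C = B / \<beta> + 1"
    \<comment> \<open>\<open>t \<le> t\<^sup>2 + 1\<close> turns the bound on the squares into one on the norms without a root.\<close>
    have bound: "norm (w k - d) \<le> C" for k
    proof -
      have "\<beta> * (norm (w k - d))\<^sup>2 \<le> B"
        using B[of k] \<alpha> by (simp add: lyapunov_def \<beta>_def) (smt (verit) mult_nonneg_nonneg zero_le_power2)
      then have "(norm (w k - d))\<^sup>2 \<le> B / \<beta>" using \<beta> by (simp add: field_simps)
      moreover have "0 \<le> (norm (w k - d) - 1)\<^sup>2" by simp
      then have "2 * norm (w k - d) - 1 \<le> (norm (w k - d))\<^sup>2" by (simp add: power2_eq_square algebra_simps)
      moreover have "0 \<le> (norm (w k - d))\<^sup>2" by simp
      ultimately show ?thesis unfolding C_def by linarith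
    qed
    have "(\<lambda>k. (norm (z k - d))\<^sup>2 - (norm (w k - d))\<^sup>2) \<longlonglongrightarrow> 0"
    proof (rule Lim_null_comparison)
      have "(\<lambda>k. norm (z k - w k) * (norm (z k - w k) + 2 * C)) \<longlonglongrightarrow> 0 * (0 + 2 * C)"
        by (intro tendsto_intros tendsto_norm_zero zw)
      then show "(\<lambda>k. norm (z k - w k) * (norm (z k - w k) + 2 * C)) \<longlonglongrightarrow> 0" by simp
      show "eventually (\<lambda>k. norm ((norm (z k - d))\<^sup>2 - (norm (w k - d))\<^sup>2)
        \<le> norm (z k - w k) * (norm (z k - w k) + 2 * C)) sequentially"
      proof (rule always_eventually, rule allI)
        fix k
        have "norm ((norm (z k - d))\<^sup>2 - (norm (w k - d))\<^sup>2)
          = \<bar>norm (z k - d) - norm (w k - d)\<bar> * (norm (z k - d) + norm (w k - d))"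
          by (simp add: power2_eq_square square_diff_square_factored abs_mult mult.commute)
        also have "\<dots> \<le> norm (z k - w k) * (norm (z k - w k) + 2 * C)"
        proof (rule mult_mono)
          show "\<bar>norm (z k - d) - norm (w k - d)\<bar> \<le> norm (z k - w k)"
            using norm_triangle_ineq3[of "z k - d" "w k - d"] by simp
          then show "norm (z k - d) + norm (w k - d) \<le> norm (z k - w k) + 2 * C"
            using bound[of k] by linarith
        qed auto
        finally show "norm ((norm (z k - d))\<^sup>2 - (norm (w k - d))\<^sup>2)
          \<le> norm (z k - w k) * (norm (z k - w k) + 2 * C)" .
      qed
    qed
    then have "(\<lambda>k. sqrt ((lyapunov d (z k) (w k) - \<alpha> * ((norm (z k - d))\<^sup>2 - (norm (w k - d))\<^sup>2)) / (\<alpha> + \<beta>)))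
      \<longlonglongrightarrow> sqrt ((e - \<alpha> * 0) / (\<alpha> + \<beta>))"
      using \<alpha> \<beta> by (intro tendsto_intros e) auto
    moreover have "(lyapunov d (z k) (w k) - \<alpha> * ((norm (z k - d))\<^sup>2 - (norm (w k - d))\<^sup>2)) / (\<alpha> + \<beta>)
      = (norm (w k - d))\<^sup>2" for k
      using \<alpha> \<beta> by (simp add: lyapunov_def \<beta>_def[symmetric] field_simps)
    ultimately show ?thesis
      by (auto simp: convergent_def)
  qed
  have cluster: "l \<in> VI_Sol F g" if r: "strict_mono r" and l: "(w \<circ> r) \<longlonglongrightarrow> l" for l r
  proof (rule limit_of_prox_steps_in_VI_Sol[OF proper convex lsc \<tau>_pos continuous_F,
        where h = "\<lambda>j. h (r j)" and b = "\<lambda>j. anchor (z (r j)) (w (r j))" and w = "\<lambda>j. w (r j)"])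
    show "(\<lambda>j. w (r j)) \<longlonglongrightarrow> l" using l by (simp add: o_def)
    have "(\<lambda>j. h (r j) - w (r j)) \<longlonglongrightarrow> 0" "(\<lambda>j. z (r j) - w (r j)) \<longlonglongrightarrow> 0"
      using LIMSEQ_subseq_LIMSEQ[OF hw r] LIMSEQ_subseq_LIMSEQ[OF zw r] by (simp_all add: o_def)
    from tendsto_add[OF \<open>(\<lambda>j. w (r j)) \<longlonglongrightarrow> l\<close> this(1)]
      tendsto_add[OF \<open>(\<lambda>j. w (r j)) \<longlonglongrightarrow> l\<close> tendsto_scaleR[OF tendsto_const[of \<alpha>] this(2)]]
    have "(\<lambda>j. w (r j) + (h (r j) - w (r j))) \<longlonglongrightarrow> l"
      "(\<lambda>j. w (r j) + \<alpha> *\<^sub>R (z (r j) - w (r j))) \<longlonglongrightarrow> l"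
      by simp_all
    then show "(\<lambda>j. h (r j)) \<longlonglongrightarrow> l" "(\<lambda>j. anchor (z (r j)) (w (r j))) \<longlonglongrightarrow> l"
      by (simp_all add: anchor_def algebra_simps)
    show "h (r j) = prox (\<lambda>y. ereal \<tau> * g y) (anchor (z (r j)) (w (r j)) - \<tau> *\<^sub>R F (w (r j)))" for j
      by (simp add: h_def half_step_def proximal_step_def)
  qed
  have "\<exists>l\<in>VI_Sol F g. w \<longlonglongrightarrow> l"
    by (rule convergent_of_convergent_distances[OF D]) (erule distances, erule (1) cluster)
  then obtain l where l: "l \<in> VI_Sol F g" "w \<longlonglongrightarrow> l" by blast
  have "(\<lambda>k. (z k - w k) + w k) \<longlonglongrightarrow> 0 + l"
    by (intro tendsto_add zw l)
  then show ?thesis using l(1) by auto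
qed

text \<open>
  The iterate and snapshot before step \<open>k\<close> are functions of the earlier draws, hence independent
  of the pair drawn in step \<open>k\<close>, so the one-step estimate for a fixed state can be averaged over the past.
\<close>

lemma random_energy_descent:
  fixes z w :: "nat \<Rightarrow> 'w \<Rightarrow> 'a"
  assumes "prob_space M" and samp: "sampling M Q p \<xi> c"
    and init: "\<And>\<omega>. \<omega> \<in> space M \<Longrightarrow> z 0 \<omega> = z0 \<and> w 0 \<omega> = z0"
    and z_step: "\<And>k \<omega>. \<omega> \<in> space M \<Longrightarrow> z (Suc k) \<omega> = full_step (z k \<omega>) (w k \<omega>) (\<xi> k \<omega>)"
    and w_step: "\<And>k \<omega>. \<omega> \<in> space M \<Longrightarrow> w (Suc k) \<omega> = (if c k \<omega> then z (Suc k) \<omega> else w k \<omega>)"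
    and s: "s \<in> VI_Sol F g"
  shows "AE \<omega> in M. convergent (\<lambda>k. lyapunov s (z k \<omega>) (w k \<omega>))
    \<and> summable (\<lambda>k. decrease (z k \<omega>) (w k \<omega>) (\<xi> k \<omega>))"
proof -
  interpret prob_space M by fact
  define N where "N = Q \<Otimes>\<^sub>M (count_space UNIV :: bool measure)"
  define Y where "Y k \<omega> = (\<xi> k \<omega>, c k \<omega>)" for k \<omega>
  have indep: "indep_vars (\<lambda>_. N) Y UNIV"
    and law: "distr M N (Y k) = Q \<Otimes>\<^sub>M measure_pmf (bernoulli_pmf p)" for k
    using samp by (simp_all add: sampling_def N_def Y_def[abs_def])
  then have Y: "Y k \<in> measurable M N" for k
    by (simp add: indep_vars_def)
  let ?G = "past_algebra M N Y"
  have sub_Suc: "subalgebra (?G (Suc k)) (?G k)" for k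
    using sets_past_mono[of Y M N, OF Y] by (simp add: subalgebra_def)
  have drawn: "\<xi> k \<in> measurable (?G (Suc k)) Q" "c k \<in> measurable (?G (Suc k)) (count_space UNIV)" for k
    using measurable_compose[OF measurable_past[of Y M N k "Suc k", OF Y] measurable_fst[of Q "count_space UNIV :: bool measure", folded N_def]]
      measurable_compose[OF measurable_past[of Y M N k "Suc k", OF Y] measurable_snd[of Q "count_space UNIV :: bool measure", folded N_def]]
    by (simp_all add: Y_def)
  have state: "z k \<in> borel_measurable (?G k) \<and> w k \<in> borel_measurable (?G k)" for k
  proof (induction k)
    case 0
    have "(\<lambda>\<omega>. z0) \<in> borel_measurable (?G 0)" by simp
    then show ?case
      using measurable_cong[of "?G 0" "z 0" "\<lambda>_. z0" borel] measurable_cong[of "?G 0" "w 0" "\<lambda>_. z0" borel] init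
      by auto
  next
    case (Suc k)
    have [measurable]: "z k \<in> borel_measurable (?G (Suc k))" "w k \<in> borel_measurable (?G (Suc k))"
      using Suc measurable_from_subalg[OF sub_Suc] by auto
    note drawn[measurable]
    have "(\<lambda>\<omega>. full_step (z k \<omega>) (w k \<omega>) (\<xi> k \<omega>)) \<in> borel_measurable (?G (Suc k))"
      by measurable
    then have z[measurable]: "z (Suc k) \<in> borel_measurable (?G (Suc k))"
      using measurable_cong[of "?G (Suc k)" "z (Suc k)"] z_step by simp
    have "(\<lambda>\<omega>. if c k \<omega> then z (Suc k) \<omega> else w k \<omega>) \<in> borel_measurable (?G (Suc k))"
      by measurable
    then have "w (Suc k) \<in> borel_measurable (?G (Suc k))"
      using measurable_cong[of "?G (Suc k)" "w (Suc k)"] w_step by simp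
    with z show ?case by blast
  qed
  then have [measurable]: "z k \<in> borel_measurable (?G k)" "w k \<in> borel_measurable (?G k)" for k by auto
  have state_M[measurable]: "z k \<in> borel_measurable M" "w k \<in> borel_measurable M" "\<xi> k \<in> measurable M Q" for k
    using state[of k] drawn(1)[of k] subalgebra_past[of Y M N, OF Y]
    by (blast intro: measurable_from_subalg)+
  show ?thesis
  proof (rule robbins_siegmund[of M ?G "\<lambda>k \<omega>. lyapunov s (z k \<omega>) (w k \<omega>)" "\<lambda>k \<omega>. decrease (z k \<omega>) (w k \<omega>) (\<xi> k \<omega>)"])
    show "subalgebra M (?G k)" "sets (?G k) \<subseteq> sets (?G (Suc k))" for k
      using subalgebra_past[of Y M N, OF Y] sets_past_mono[of Y M N, OF Y] by auto
    show "(\<lambda>\<omega>. lyapunov s (z k \<omega>) (w k \<omega>)) \<in> borel_measurable (?G k)" for k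
      by measurable
    show "(\<lambda>\<omega>. decrease (z k \<omega>) (w k \<omega>) (\<xi> k \<omega>)) \<in> borel_measurable M" for k
      by measurable
    have "(\<integral>\<^sup>+\<omega>. ennreal (lyapunov s (z 0 \<omega>) (w 0 \<omega>)) \<partial>M) = (\<integral>\<^sup>+\<omega>. ennreal (lyapunov s z0 z0) \<partial>M)"
      using init by (intro nn_integral_cong) simp
    then show "(\<integral>\<^sup>+\<omega>. ennreal (lyapunov s (z 0 \<omega>) (w 0 \<omega>)) \<partial>M) < \<infinity>"
      by (simp add: emeasure_space_1)
  next
    fix k A assume A: "A \<in> sets (?G k)"
    \<comment> \<open>The indicator of the past event is made part of the state.\<close>
    define S where "S \<omega> = (z k \<omega>, w k \<omega>, indicator A \<omega> :: ennreal)" for \<omega>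
    define f where "f = (\<lambda>((a, b, i), (x, d)). i *
      ennreal (lyapunov s (full_step a b x) (if d then full_step a b x else b) + decrease a b x))"
    have S: "S \<in> measurable (?G k) (borel \<Otimes>\<^sub>M borel \<Otimes>\<^sub>M borel)"
      using A unfolding S_def by measurable
    have f: "f \<in> borel_measurable ((borel \<Otimes>\<^sub>M borel \<Otimes>\<^sub>M borel) \<Otimes>\<^sub>M N)"
      unfolding f_def N_def case_prod_beta' by measurable
    have "(\<integral>\<^sup>+\<omega>. ennreal (lyapunov s (z (Suc k) \<omega>) (w (Suc k) \<omega>) + decrease (z k \<omega>) (w k \<omega>) (\<xi> k \<omega>))
        * indicator A \<omega> \<partial>M) = (\<integral>\<^sup>+\<omega>. f (S \<omega>, Y k \<omega>) \<partial>M)"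
      by (intro nn_integral_cong) (simp add: f_def S_def Y_def z_step w_step mult.commute)
    also have "\<dots> = (\<integral>\<^sup>+\<omega>. \<integral>\<^sup>+y. f (S \<omega>, y) \<partial>distr M N (Y k) \<partial>M)"
      by (rule nn_integral_past_present[OF Y \<open>prob_space M\<close> indep S f])
    also have "\<dots> \<le> (\<integral>\<^sup>+\<omega>. ennreal (lyapunov s (z k \<omega>) (w k \<omega>)) * indicator A \<omega> \<partial>M)"
    proof (rule nn_integral_mono)
      fix \<omega> assume "\<omega> \<in> space M"
      let ?h = "\<lambda>(x, d). ennreal (lyapunov s (full_step (z k \<omega>) (w k \<omega>) x)
        (if d then full_step (z k \<omega>) (w k \<omega>) x else w k \<omega>) + decrease (z k \<omega>) (w k \<omega>) x)"
      have h: "?h \<in> borel_measurable (Q \<Otimes>\<^sub>M measure_pmf (bernoulli_pmf p))"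
        by measurable
      have "(\<integral>\<^sup>+y. f (S \<omega>, y) \<partial>distr M N (Y k))
        = (\<integral>\<^sup>+y. indicator A \<omega> * ?h y \<partial>(Q \<Otimes>\<^sub>M measure_pmf (bernoulli_pmf p)))"
        unfolding law by (intro nn_integral_cong) (auto simp: f_def S_def)
      also have "\<dots> = indicator A \<omega> * (\<integral>\<^sup>+y. ?h y \<partial>(Q \<Otimes>\<^sub>M measure_pmf (bernoulli_pmf p)))"
        by (rule nn_integral_cmult[OF h])
      also have "\<dots> \<le> indicator A \<omega> * ennreal (lyapunov s (z k \<omega>) (w k \<omega>))"
        by (intro mult_left_mono mean_descent[OF s]) simp
      finally show "(\<integral>\<^sup>+y. f (S \<omega>, y) \<partial>distr M N (Y k))
        \<le> ennreal (lyapunov s (z k \<omega>) (w k \<omega>)) * indicator A \<omega>"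
        by (simp add: mult.commute)
    qed
    finally show "(\<integral>\<^sup>+\<omega>. ennreal (lyapunov s (z (Suc k) \<omega>) (w (Suc k) \<omega>) + decrease (z k \<omega>) (w k \<omega>) (\<xi> k \<omega>))
        * indicator A \<omega> \<partial>M) \<le> (\<integral>\<^sup>+\<omega>. ennreal (lyapunov s (z k \<omega>) (w k \<omega>)) * indicator A \<omega> \<partial>M)" .
  qed (fact | rule lyapunov_nonneg decrease_nonneg)+
qed

end

theorem theorem2p3:
  fixes g :: "'a::euclidean_space \<Rightarrow> ereal"
    and F :: "'a \<Rightarrow> 'a"
    and Fo :: "'x \<Rightarrow> 'a \<Rightarrow> 'a"
    and Q :: "'x measure"
    and M :: "'w measure"
    and \<xi> :: "nat \<Rightarrow> 'w \<Rightarrow> 'x"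
    and c :: "nat \<Rightarrow> 'w \<Rightarrow> bool"
    and z zh w :: "nat \<Rightarrow> 'w \<Rightarrow> 'a"
    and z0 :: 'a
    and L \<alpha> p \<tau> \<gamma> :: real
  assumes "proper_fun g" and "econvex_fun g" and "lsc_fun g"
    and "VI_Sol F g \<noteq> {}"
    and "monotone_operator_on (edom g) F"
    and "prob_space Q"
    and "unbiased_oracle Q Fo F"
    and "L > 0" and "lipschitz_in_mean Q Fo L"
    and "\<forall>x\<in>space Q. continuous_on UNIV (Fo x)"
    and "0 \<le> \<alpha>" and "\<alpha> < 1"
    and "0 < p" and "p \<le> 1"
    and "0 < \<gamma>" and "\<gamma> < 1"
    and "\<tau> = sqrt (1 - \<alpha>) / L * \<gamma>"
    and "prob_space M"
    and "sampling M Q p \<xi> c"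
    and "\<forall>\<omega>\<in>space M. extragradient_vr g F Fo \<alpha> \<tau> z0 (\<lambda>k. \<xi> k \<omega>) (\<lambda>k. c k \<omega>)
           (\<lambda>k. z k \<omega>) (\<lambda>k. zh k \<omega>) (\<lambda>k. w k \<omega>)"
  shows "AE \<omega> in M. \<exists>zstar\<in>VI_Sol F g. (\<lambda>k. z k \<omega>) \<longlonglongrightarrow> zstar"
proof -
  interpret extragradient_setting g F Fo Q L \<alpha> p \<tau> \<gamma>
    by (rule extragradient_setting.intro) fact+
  have init: "z 0 \<omega> = z0 \<and> w 0 \<omega> = z0"
    and z_step: "z (Suc k) \<omega> = full_step (z k \<omega>) (w k \<omega>) (\<xi> k \<omega>)"
    and w_step: "w (Suc k) \<omega> = (if c k \<omega> then z (Suc k) \<omega> else w k \<omega>)"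
    if "\<omega> \<in> space M" for k \<omega>
    using assms(20) that
    by (simp_all add: extragradient_vr_def Let_def full_step_def half_step_def anchor_def proximal_step_def)
  \<comment> \<open>A countable set of solutions keeps the exceptional set null.\<close>
  obtain D where D: "countable D" "D \<subseteq> VI_Sol F g" "VI_Sol F g \<subseteq> closure D"
    by (rule separable)
  have "AE \<omega> in M. convergent (\<lambda>k. lyapunov d (z k \<omega>) (w k \<omega>))
    \<and> summable (\<lambda>k. decrease (z k \<omega>) (w k \<omega>) (\<xi> k \<omega>))" if "d \<in> D" for d
    using D(2) that
    by (intro random_energy_descent[where c = c and ?z0.0 = z0] assms(18,19) init z_step w_step) auto
  then have "AE \<omega> in M. \<forall>d\<in>D. convergent (\<lambda>k. lyapunov d (z k \<omega>) (w k \<omega>))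
    \<and> summable (\<lambda>k. decrease (z k \<omega>) (w k \<omega>) (\<xi> k \<omega>))"
    using D(1) by (simp add: AE_ball_countable)
  then show ?thesis
    using AE_space
  proof eventually_elim
    case (elim \<omega>)
    have "D \<noteq> {}" using D(3) assms(4) by auto
    show ?case
    proof (rule trajectory_converges[OF D(2,3) assms(4)])
      show "w (Suc k) \<omega> = z (Suc k) \<omega> \<or> w (Suc k) \<omega> = w k \<omega>" for k
        using w_step[OF elim(2)] by simp
      show "summable (\<lambda>k. decrease (z k \<omega>) (w k \<omega>) (\<xi> k \<omega>))"
        using elim(1) \<open>D \<noteq> {}\<close> by blast
    qed (use elim z_step in auto)
  qed
qed

end
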